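(* Let $a\in C^1(\mathbb{R})$ be real-valued with $a_0:=\inf_{z\in\mathbb{R}}a(z)>0$ and $\partial_za\in L^\infty(\mathbb{R})$. Then there exists a constant $\mathscr{C}>0$ such that all normalized solutions $\Phi(x,z,t)=(f,g)^T$ of the system $$\partial_tf=\partial_x[\partial_xf+a(z)xf],$$ $$\partial_tg=\partial_x[\partial_xg+a(z)xg]+(\partial_za(z))\,[x\partial_xf+f],$$ with $x\in\mathbb{R}$, $z\in\mathbb{R}$, $t\ge 0$, and with steady state $\Phi^\infty(x,z):=(f^\infty,g^\infty)^T$, satisfy $$\sup_{z\in\mathbb{R}}\|\Phi(\cdot,z,t)-\Phi^\infty(\cdot,z)\|^2_{L^2((f^\infty)^{-1})}\le\mathscr{C}(1+t^2)e^{-2a_0t}\sup_{z\in\mathbb{R}}\|\Phi(\cdot,z,0)-\Phi^\infty(\cdot,z)\|^2_{L^2((f^\infty)^{-1})},\qquad t\ge 0,$$ with the explicit constant, depending only on $a_0$ and $\|\partial_za\|_\infty$, $$\mathscr{C}=2\max\{1,a_0^2\}\left[12\max\Big\{2,1+\frac{\|\partial_za\|_\infty^2}{a_0^2}\Big\}\Big(7+\frac{21}{4}\frac{\|\partial_za\|_\infty^4}{a_0^4}\Big)+2\Big(1+\frac{\|\partial_za\|_\infty^4}{a_0^4}\Big)\right].$$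
   Context: The steady states are $f^\infty(x,z):=\sqrt{\frac{a(z)}{2\pi}}\,e^{-\frac{x^2}{2}a(z)}$ and $g^\infty(x,z):=\partial_zf^\infty(x,z)$. For each fixed $z$, $L^2((f^\infty)^{-1})$ is the weighted space over $\mathbb{R}$ with inner product $\langle\phi,\psi\rangle=\int_{\mathbb{R}}\phi(x)\psi(x)\,(f^\infty(x,z))^{-1}dx$ (the weight depends on $z$), and for $\Phi=(f,g)^T$ one sets $\|\Phi\|^2_{L^2((f^\infty)^{-1})}=\|f\|^2_{L^2((f^\infty)^{-1})}+\|g\|^2_{L^2((f^\infty)^{-1})}$. Here $f(x,z,t)$ is a probability density in $x$ solving the first equation with initial datum $f^0(x,z)$, where $z\in\mathbb{R}$ is a parameter, and $g:=\partial_zf$ is its parameter derivative, solving the second equation with initial datum $g^0(x,z)$. "Normalized" means that for all $z\in\mathbb{R}$: $f^0(\cdot,z),g^0(\cdot,z)\in L^2((f^\infty)^{-1})$, $\int_{\mathbb{R}}f^0(x,z)\,dx=1$ and $\int_{\mathbb{R}}g^0(x,z)\,dx=0$. *)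

theory Defs
  imports "HOL-Probability.Probability"
begin

definition f_inf :: "(real \<Rightarrow> real) \<Rightarrow> real \<Rightarrow> real \<Rightarrow> real" where
  "f_inf a x z = sqrt (a z / (2 * pi)) * exp (- (x\<^sup>2 / 2) * a z)"

definition g_inf :: "(real \<Rightarrow> real) \<Rightarrow> real \<Rightarrow> real \<Rightarrow> real" where
  "g_inf a x z = deriv (\<lambda>\<zeta>. f_inf a x \<zeta>) z"

text \<open>The squared norm of the weighted space with weight \<open>1 / f_inf a \<cdot> z\<close> takes values in
  \<open>ennreal\<close>: it is \<open>\<infinity>\<close> on measurable functions outside that space, so that suprema over
  \<open>z\<close> need no finiteness assumption.\<close>

definition wnorm_sq :: "(real \<Rightarrow> real) \<Rightarrow> real \<Rightarrow> (real \<Rightarrow> real) \<Rightarrow> ennreal" where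
  "wnorm_sq a z \<phi> = (\<integral>\<^sup>+ x. ennreal ((\<phi> x)\<^sup>2 * inverse (f_inf a x z)) \<partial>lebesgue)"

definition weighted_L2 :: "(real \<Rightarrow> real) \<Rightarrow> real \<Rightarrow> (real \<Rightarrow> real) set" where
  "weighted_L2 a z = {\<phi> \<in> borel_measurable lebesgue. wnorm_sq a z \<phi> < \<infinity>}"

definition pair_norm_sq ::
    "(real \<Rightarrow> real) \<Rightarrow> real \<Rightarrow> (real \<Rightarrow> real) \<Rightarrow> (real \<Rightarrow> real) \<Rightarrow> ennreal" where
  "pair_norm_sq a z \<phi> \<psi> = wnorm_sq a z \<phi> + wnorm_sq a z \<psi>"

definition Linf_norm :: "(real \<Rightarrow> real) \<Rightarrow> ereal" where
  "Linf_norm u = esssup lebesgue (\<lambda>z. ereal \<bar>u z\<bar>)"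

text \<open>Solution concept, for each fixed parameter \<open>z\<close>: the evolution takes place in the weighted
  \<open>L\<^sup>2\<close> space, continuously in \<open>t \<ge> 0\<close> (so the initial datum, which need not be smooth, is attained
  in norm), and the equations hold pointwise for \<open>t > 0\<close>, where the functions have the derivatives
  occurring in the equations as continuous functions of \<open>(x, t)\<close>. Continuity in norm is what rules out
  the non-unique rapidly growing solutions of the heat-type equation.\<close>

definition L2_continuous :: "(real \<Rightarrow> real) \<Rightarrow> real \<Rightarrow> (real \<Rightarrow> real \<Rightarrow> real) \<Rightarrow> bool" where
  "L2_continuous a z u \<longleftrightarrow>
     (\<forall>t\<ge>0. (\<lambda>x. u x t) \<in> weighted_L2 a z) \<and>
     (\<forall>t\<ge>0. ((\<lambda>s. wnorm_sq a z (\<lambda>x. u x s - u x t)) \<longlongrightarrow> 0) (at t within {0..}))"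

definition d_t :: "(real \<Rightarrow> real \<Rightarrow> real) \<Rightarrow> real \<Rightarrow> real \<Rightarrow> real" where
  "d_t u x t = deriv (\<lambda>s. u x s) t"

definition d_x :: "(real \<Rightarrow> real \<Rightarrow> real) \<Rightarrow> real \<Rightarrow> real \<Rightarrow> real" where
  "d_x u x t = deriv (\<lambda>y. u y t) x"

definition C21 :: "(real \<Rightarrow> real \<Rightarrow> real) \<Rightarrow> bool" where
  "C21 u \<longleftrightarrow>
     (\<forall>x. \<forall>t>0. (\<lambda>s. u x s) differentiable (at t) \<and>
                (\<lambda>y. u y t) differentiable (at x) \<and>
                (\<lambda>y. d_x u y t) differentiable (at x)) \<and>
     continuous_on (UNIV \<times> {0<..}) (\<lambda>(x, t). d_t u x t) \<and>
     continuous_on (UNIV \<times> {0<..}) (\<lambda>(x, t). d_x u x t) \<and>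
     continuous_on (UNIV \<times> {0<..}) (\<lambda>(x, t). d_x (d_x u) x t)"

definition solves_system ::
    "(real \<Rightarrow> real) \<Rightarrow> (real \<Rightarrow> real \<Rightarrow> real \<Rightarrow> real) \<Rightarrow> (real \<Rightarrow> real \<Rightarrow> real \<Rightarrow> real) \<Rightarrow> bool" where
  "solves_system a f g \<longleftrightarrow>
     (\<forall>z. L2_continuous a z (\<lambda>x t. f x z t) \<and> L2_continuous a z (\<lambda>x t. g x z t) \<and>
          C21 (\<lambda>x t. f x z t) \<and> C21 (\<lambda>x t. g x z t) \<and>
          (\<forall>x. \<forall>t>0.
             d_t (\<lambda>x t. f x z t) x t
               = d_x (\<lambda>x t. d_x (\<lambda>x t. f x z t) x t + a z * x * f x z t) x t \<and>
             d_t (\<lambda>x t. g x z t) x t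
               = d_x (\<lambda>x t. d_x (\<lambda>x t. g x z t) x t + a z * x * g x z t) x t
                 + deriv a z * (x * d_x (\<lambda>x t. f x z t) x t + f x z t)))"

text \<open>Members of the weighted space are integrable by Cauchy--Schwarz, so the Bochner integrals
  below are genuine.\<close>

definition normalized ::
    "(real \<Rightarrow> real) \<Rightarrow> (real \<Rightarrow> real \<Rightarrow> real) \<Rightarrow> (real \<Rightarrow> real \<Rightarrow> real) \<Rightarrow> bool" where
  "normalized a f0 g0 \<longleftrightarrow>
     (\<forall>z. (\<lambda>x. f0 x z) \<in> weighted_L2 a z \<and> (\<lambda>x. g0 x z) \<in> weighted_L2 a z \<and>
          (LINT x|lebesgue. f0 x z) = 1 \<and> (LINT x|lebesgue. g0 x z) = 0)"

definition decay_const :: "real \<Rightarrow> real \<Rightarrow> real" where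
  "decay_const a0 M =
     2 * max 1 (a0\<^sup>2) *
       (12 * max 2 (1 + M\<^sup>2 / a0\<^sup>2) * (7 + 21 / 4 * (M ^ 4 / a0 ^ 4))
        + 2 * (1 + M ^ 4 / a0 ^ 4))"

end

theory Submission
  imports Defs
begin

text \<open>For fixed \<open>z\<close>, put \<open>\<alpha> = a z\<close> and \<open>\<beta> = a' z\<close> and test both equations against the monic Hermite
  polynomials \<open>H\<^sub>n\<close> of the Gaussian with variance \<open>1 / \<alpha>\<close>. The moments \<open>f\<^sub>n\<close>, \<open>g\<^sub>n\<close> of a solution satisfy
  the triangular system \<open>f\<^sub>n' = - \<alpha> n f\<^sub>n\<close>,
  \<open>g\<^sub>n' = - \<alpha> n g\<^sub>n - \<beta> n (f\<^sub>n + (n - 1) / \<alpha> f\<^sub>n\<^sub>-\<^sub>2)\<close>, which is solved explicitly. By Parseval the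
  squared weighted norm is the sum of the squared moments with weights \<open>\<alpha>\<^sup>n / n!\<close>, so bounding the
  explicit coefficients uniformly in \<open>n\<close> gives the decay; subtracting the steady state kills
  the moments of order \<open>0\<close>, and the resonance in \<open>g\<^sub>1\<close> produces the factor \<open>t\<^sup>2\<close>. The derivative of \<open>f\<close>
  in the source term is moved onto the polynomials, so no regularity of the initial data is used.\<close>

section \<open>Square integrable functions and determinacy by moments\<close>

text \<open>Nothing is known about the spatial derivatives of a solution at infinity, so a moment
  over the whole line cannot be differentiated under the integral directly. The only control there
  is the weighted norm, which norm continuity bounds locally in time. Hence all derivatives are
  moved onto polynomials cut off at -R and R, and R tends to infinity with errors uniform in time
  near t. The initial datum enters only through continuity of the moments at time 0. The delicate
  point of the coefficient bounds is that the source carries the unbounded factors n and n (n - 1).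
  The first is absorbed by the surplus powers of exp (- \<alpha> t) present in every degree above 1.
  After squaring, the second meets the ratio of the weights of degrees n and n - 2, which leaves a
  single n (n - 1); this is absorbed by the difference of two exponentials produced by variation of
  constants. Degree 2 drops out because the deviation has no moment of order 0. The coefficients
  obtained this way are smaller than the constant of the theorem and are compared with it only at
  the end.\<close>

definition sq_integrable :: "'a measure \<Rightarrow> ('a \<Rightarrow> real) \<Rightarrow> bool" where
  "sq_integrable M h \<longleftrightarrow> h \<in> borel_measurable M \<and> integrable M (\<lambda>x. (h x)\<^sup>2)"

lemma sq_integrable_measurable: "sq_integrable M h \<Longrightarrow> h \<in> borel_measurable M"
  by (simp add: sq_integrable_def)

lemma sq_integrable_square: "sq_integrable M h \<Longrightarrow> integrable M (\<lambda>x. (h x)\<^sup>2)"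
  by (simp add: sq_integrable_def)

lemma sq_integrable_bound:
  assumes "h \<in> borel_measurable M" "integrable M w" "\<And>x. (h x)\<^sup>2 \<le> w x"
  shows "sq_integrable M h"
  unfolding sq_integrable_def
  using assms(1) by (auto intro!: Bochner_Integration.integrable_bound[OF assms(2)]
      simp: order_trans[OF assms(3) abs_ge_self])

lemma sq_integrable_mult:
  assumes "sq_integrable M h" "sq_integrable M k"
  shows "integrable M (\<lambda>x. h x * k x)"
proof (rule Bochner_Integration.integrable_bound)
  show "integrable M (\<lambda>x. (h x)\<^sup>2 + (k x)\<^sup>2)"
    using assms by (simp add: sq_integrable_def)
  show "(\<lambda>x. h x * k x) \<in> borel_measurable M"
    by (intro borel_measurable_times sq_integrable_measurable assms)
  have "\<bar>u * v\<bar> \<le> \<bar>u\<^sup>2 + v\<^sup>2\<bar>" for u v :: real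
    using sum_squares_bound[of "\<bar>u\<bar>" "\<bar>v\<bar>"] mult_nonneg_nonneg[of "\<bar>u\<bar>" "\<bar>v\<bar>"]
    unfolding abs_mult power2_abs by linarith
  then show "AE x in M. norm (h x * k x) \<le> norm ((h x)\<^sup>2 + (k x)\<^sup>2)"
    by simp
qed

lemma sq_integrable_add [intro]:
  assumes "sq_integrable M h" "sq_integrable M k"
  shows "sq_integrable M (\<lambda>x. h x + k x)"
proof (rule sq_integrable_bound)
  show "integrable M (\<lambda>x. 2 * (h x)\<^sup>2 + 2 * (k x)\<^sup>2)"
    using assms by (simp add: sq_integrable_def)
  show "(\<lambda>x. h x + k x) \<in> borel_measurable M"
    by (intro borel_measurable_add sq_integrable_measurable assms)
  show "(h x + k x)\<^sup>2 \<le> 2 * (h x)\<^sup>2 + 2 * (k x)\<^sup>2" for x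
    using sum_squares_bound[of "h x" "k x"] by (simp add: power2_sum)
qed

lemma sq_integrable_cmult [intro]:
  "sq_integrable M h \<Longrightarrow> sq_integrable M (\<lambda>x. c * h x)"
  by (auto simp: sq_integrable_def power_mult_distrib intro: borel_measurable_times)

lemma sq_integrable_diff [intro]:
  assumes "sq_integrable M h" "sq_integrable M k"
  shows "sq_integrable M (\<lambda>x. h x - k x)"
  using sq_integrable_add[OF assms(1) sq_integrable_cmult[OF assms(2), of "-1"]] by simp

lemma sq_integrable_sum [intro]:
  assumes "\<And>i. i \<in> I \<Longrightarrow> sq_integrable M (h i)"
  shows "sq_integrable M (\<lambda>x. \<Sum>i\<in>I. h i x)"
  using assms
proof (induction I rule: infinite_finite_induct)
  case (insert i I)
  then show ?case by auto
qed (simp_all add: sq_integrable_def)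

text \<open>Expanding the integral of the square of \<open>A * h - B * k\<close> gives A (A H - B^2)
  >= 0, which can be divided by A unless A = 0; in that case k vanishes almost everywhere and B =
  0.\<close>

lemma integral_Cauchy_Schwarz:
  assumes "sq_integrable M h" "sq_integrable M k"
  shows "(\<integral>x. h x * k x \<partial>M)\<^sup>2 \<le> (\<integral>x. (h x)\<^sup>2 \<partial>M) * (\<integral>x. (k x)\<^sup>2 \<partial>M)"
proof -
  define A B H where "A = (\<integral>x. (k x)\<^sup>2 \<partial>M)" and "B = (\<integral>x. h x * k x \<partial>M)" 
    and "H = (\<integral>x. (h x)\<^sup>2 \<partial>M)"
  note int = sq_integrable_square[OF assms(1)] sq_integrable_square[OF assms(2)]
    sq_integrable_mult[OF assms]
  have A: "A \<ge> 0" by (simp add: A_def)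
  have "0 \<le> (\<integral>x. (A * h x - B * k x)\<^sup>2 \<partial>M)" by simp
  also have "\<dots> = (\<integral>x. A\<^sup>2 * (h x)\<^sup>2 - 2 * A * B * (h x * k x) + B\<^sup>2 * (k x)\<^sup>2 \<partial>M)"
    by (simp add: power2_eq_square algebra_simps)
  also have "\<dots> = A\<^sup>2 * H - 2 * A * B * B + B\<^sup>2 * A"
    using int by (simp add: A_def B_def H_def)
  also have "\<dots> = A * (A * H - B\<^sup>2)"
    by (simp add: power2_eq_square algebra_simps)
  finally have *: "0 \<le> A * (A * H - B\<^sup>2)" .
  show ?thesis
  proof (cases "A = 0")
    case True
    then have "AE x in M. (k x)\<^sup>2 = 0"
      using integral_nonneg_eq_0_iff_AE[OF int(2)] by (simp add: A_def)
    then have "AE x in M. h x * k x = 0" by eventually_elim simp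
    then have "B = 0" unfolding B_def by (rule integral_eq_zero_AE)
    then show ?thesis by (simp add: B_def)
  next
    case False
    with A * have "0 \<le> A * H - B\<^sup>2" by (simp add: zero_le_mult_iff)
    then show ?thesis by (simp add: A_def B_def H_def mult.commute)
  qed
qed

lemma square_add_le: "(u + v)\<^sup>2 \<le> 2 * u\<^sup>2 + 2 * v\<^sup>2" for u v :: real
  using sum_squares_bound[of u v] by (simp add: power2_sum)

section \<open>Parseval's identity for a total orthonormal sequence\<close>

text \<open>Bessel's inequality makes the coefficients square summable, so the series has a limit
  \<open>T\<close> in the mean. Since \<open>h - T\<close> is orthogonal to every
  \<open>e n\<close>, the assumption \<open>total\<close> identifies \<open>T\<close> with
  \<open>h\<close> almost everywhere. The limit is constructed as an actual function because
  elements here are functions, not classes modulo null sets.\<close>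

lemma Parseval:
  fixes M :: "'a measure" and e :: "nat \<Rightarrow> 'a \<Rightarrow> real"
  assumes e: "\<And>n. sq_integrable M (e n)"
    and orth: "\<And>m n. (\<integral>x. e m x * e n x \<partial>M) = (if m = n then 1 else 0)"
    and total: "\<And>h. sq_integrable M h \<Longrightarrow> (\<And>n. (\<integral>x. h x * e n x \<partial>M) = 0) \<Longrightarrow> AE x in M. h x = 0"
    and h: "sq_integrable M h"
  shows "(\<lambda>n. (\<integral>x. h x * e n x \<partial>M)\<^sup>2) sums (\<integral>x. (h x)\<^sup>2 \<partial>M)"
proof -
  define c where "c n = (\<integral>x. h x * e n x \<partial>M)" for n
  define S where "S I x = (\<Sum>n\<in>I. c n * e n x)" for I x
  note [simp] = sq_integrable_mult[OF e e] sq_integrable_mult[OF h e]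
  have S: "sq_integrable M (S I)" for I
    unfolding S_def by (intro sq_integrable_sum sq_integrable_cmult e)
  have Se: "(\<integral>x. S I x * e n x \<partial>M) = (if n \<in> I then c n else 0)" if "finite I" for I n
  proof -
    have "(\<integral>x. S I x * e n x \<partial>M) = (\<integral>x. (\<Sum>m\<in>I. c m * (e m x * e n x)) \<partial>M)"
      by (simp add: S_def sum_distrib_right mult.assoc)
    also have "\<dots> = (\<Sum>m\<in>I. if m = n then c m else 0)"
      by (simp add: orth if_distrib cong: if_cong)
    finally show ?thesis using that by simp
  qed
  have SS: "(\<integral>x. (S I x)\<^sup>2 \<partial>M) = (\<Sum>n\<in>I. (c n)\<^sup>2)" if "finite I" for I
  proof -
    have "(\<integral>x. (S I x)\<^sup>2 \<partial>M) = (\<integral>x. (\<Sum>m\<in>I. c m * (S I x * e m x)) \<partial>M)"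
    proof (rule Bochner_Integration.integral_cong[OF refl])
      fix x
      show "(S I x)\<^sup>2 = (\<Sum>m\<in>I. c m * (S I x * e m x))"
        unfolding power2_eq_square by (subst (2) S_def) (simp add: sum_distrib_left mult_ac)
    qed
    also have "\<dots> = (\<Sum>m\<in>I. c m * (if m \<in> I then c m else 0))"
      using sq_integrable_mult[OF S e] Se[OF that] by simp
    finally show ?thesis by (simp add: power2_eq_square)
  qed
  have hS: "(\<integral>x. (h x - S I x)\<^sup>2 \<partial>M) = (\<integral>x. (h x)\<^sup>2 \<partial>M) - (\<Sum>n\<in>I. (c n)\<^sup>2)" if "finite I" for I
  proof -
    have 1: "(\<integral>x. h x * S I x \<partial>M) = (\<Sum>n\<in>I. (c n)\<^sup>2)"
    proof -
      have "(\<integral>x. h x * S I x \<partial>M) = (\<integral>x. (\<Sum>m\<in>I. c m * (h x * e m x)) \<partial>M)"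
        by (simp add: S_def sum_distrib_left mult_ac)
      then show ?thesis by (simp add: c_def power2_eq_square)
    qed
    have "(\<integral>x. (h x - S I x)\<^sup>2 \<partial>M) = (\<integral>x. (h x)\<^sup>2 - 2 * (h x * S I x) + (S I x)\<^sup>2 \<partial>M)"
      by (simp add: power2_diff algebra_simps)
    also have "\<dots> = (\<integral>x. (h x)\<^sup>2 \<partial>M) - 2 * (\<Sum>n\<in>I. (c n)\<^sup>2) + (\<Sum>n\<in>I. (c n)\<^sup>2)"
      using sq_integrable_square[OF h] sq_integrable_square[OF S] sq_integrable_mult[OF h S]
      by (simp add: 1 SS[OF that])
    finally show ?thesis by simp
  qed
  have bessel: "(\<Sum>n\<in>I. (c n)\<^sup>2) \<le> (\<integral>x. (h x)\<^sup>2 \<partial>M)" if "finite I" for I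
    using hS[OF that] integral_nonneg_AE[of "\<lambda>x. (h x - S I x)\<^sup>2" M] by simp
  have summ: "summable (\<lambda>n. (c n)\<^sup>2)"
    by (rule bounded_imp_summable[of _ "(\<integral>x. (h x)\<^sup>2 \<partial>M)"]) (auto intro: bessel)
  \<comment> \<open>Riesz--Fischer: along indices with geometric tails the partial sums converge almost everywhere;
    by totality the limit is \<open>h\<close>.\<close>
  have "\<exists>N. \<forall>m\<ge>N. \<forall>n. (\<Sum>j=m..<n. (c j)\<^sup>2) < (1/4)^k" for k
  proof -
    have "(1/4::real)^k > 0" by simp
    then obtain N where "\<forall>m\<ge>N. \<forall>n. norm (\<Sum>j=m..<n. (c j)\<^sup>2) < (1/4)^k"
      using summ unfolding summable_Cauchy by blast
    then show ?thesis by (intro exI[of _ N]) (simp add: sum_nonneg)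
  qed
  then obtain N where N: "\<And>k m n. m \<ge> N k \<Longrightarrow> (\<Sum>j=m..<n. (c j)\<^sup>2) < (1/4)^k"
    by metis
  \<comment> \<open>\<open>N\<close> need not be monotone. The sum makes \<open>r\<close> monotone,
    and the summand k gives \<open>r k\<close> >= k, so every fixed index n eventually lies below
    \<open>r j\<close>.\<close>
  define r where "r k = (\<Sum>j\<le>k. N j) + k" for k
  have rN: "r k \<ge> N k" "r k \<ge> k" for k
    by (auto simp: r_def intro: trans_le_add1 member_le_sum)
  have r_mono: "r j \<le> r k" if "j \<le> k" for j k
    unfolding r_def using that by (intro add_mono sum_mono2) auto
  define s where "s k = S {..<r k}" for k
  have sd: "s k x - s j x = S {r j..<r k} x" if "j \<le> k" for j k x
  proof -
    have "{..<r k} = {..<r j} \<union> {r j..<r k}" using r_mono[OF that] by auto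
    moreover have "{..<r j} \<inter> {r j..<r k} = {}" by auto
    ultimately show ?thesis unfolding s_def S_def by (simp add: sum.union_disjoint)
  qed
  have sdist: "(\<integral>x. (s k x - s j x)\<^sup>2 \<partial>M) \<le> (1/4)^j" if "j \<le> k" for j k
    using N[OF rN(1), of j "r k"] by (simp add: sd[OF that] SS)
  have s_int: "sq_integrable M (s k)" for k by (simp add: s_def S)
  have s_meas[measurable]: "s k \<in> borel_measurable M" for k
    using s_int by (simp add: sq_integrable_def)
  define d where "d k x = s (Suc k) x - s k x" for k x
  have d_int: "sq_integrable M (d k)" for k
    unfolding d_def by (intro sq_integrable_diff s_int)
  have d_meas[measurable]: "d k \<in> borel_measurable M" for k
    using d_int by (simp add: sq_integrable_def)
  \<comment> \<open>Tails of size 4^-k leave room for the weight 2^k: the weighted integrals are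
    still bounded by the summable 2^-k. This weight is what later turns square summability of the
    increments into absolute summability.\<close>
  have nn_d: "(\<integral>\<^sup>+x. ennreal (2^k * (d k x)\<^sup>2) \<partial>M) \<le> ennreal ((1/2)^k)" for k
  proof -
    have "(\<integral>\<^sup>+x. ennreal (2^k * (d k x)\<^sup>2) \<partial>M) = ennreal (\<integral>x. 2^k * (d k x)\<^sup>2 \<partial>M)"
      using sq_integrable_square[OF d_int] by (intro nn_integral_eq_integral) auto
    also have "(\<integral>x. 2^k * (d k x)\<^sup>2 \<partial>M) \<le> 2^k * (1/4)^k"
      using sdist[of k "Suc k"] by (simp add: d_def)
    also have "\<dots> = (1/2)^k" by (simp flip: power_mult_distrib)
    finally show ?thesis by (simp add: ennreal_leI)
  qed
  have "(\<integral>\<^sup>+x. (\<Sum>k. ennreal (2^k * (d k x)\<^sup>2)) \<partial>M) = (\<Sum>k. \<integral>\<^sup>+x. ennreal (2^k * (d k x)\<^sup>2) \<partial>M)"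
    by (intro nn_integral_suminf) auto
  also have "\<dots> \<le> (\<Sum>k. ennreal ((1/2)^k))"
    by (intro suminf_le nn_d) auto
  also have "\<dots> = ennreal (\<Sum>k. (1/2)^k)"
    by (intro suminf_ennreal2) (auto simp: summable_geometric)
  finally have "(\<integral>\<^sup>+x. (\<Sum>k. ennreal (2^k * (d k x)\<^sup>2)) \<partial>M) \<noteq> \<infinity>"
    by (auto simp: top_unique)
  then have "AE x in M. (\<Sum>k. ennreal (2^k * (d k x)\<^sup>2)) \<noteq> \<infinity>"
    by (intro nn_integral_noteq_infinite) auto
  then have conv: "AE x in M. convergent (\<lambda>k. s k x)"
  proof eventually_elim
    case (elim x)
    have "summable (\<lambda>k. 2^k * (d k x)\<^sup>2)"
      using elim by (intro summable_suminf_not_top) auto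
    moreover have "summable (\<lambda>k. (1/2::real)^k)" by (simp add: summable_geometric)
    ultimately have sm: "summable (\<lambda>k. 2^k * (d k x)\<^sup>2 + (1/2::real)^k)" by (rule summable_add)
    have "summable (\<lambda>k. d k x)"
    proof (rule summable_comparison_test'[OF sm])
      fix k :: nat
      \<comment> \<open>Dividing this square by 2^k yields 2 |d| <= 2^k d^2 + 2^-k, a summable
        majorant of the increments.\<close>
      have "0 \<le> (2^k * \<bar>d k x\<bar> - 1)\<^sup>2" by simp
      then have "2 * (2^k * \<bar>d k x\<bar>) \<le> (2^k)\<^sup>2 * (d k x)\<^sup>2 + 1"
        by (simp add: power2_diff power_mult_distrib)
      then have "2^k * (2 * \<bar>d k x\<bar>) \<le> 2^k * (2^k * (d k x)\<^sup>2 + (1/2)^k)"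
        by (simp add: algebra_simps power2_eq_square power_one_over)
      then have "2 * \<bar>d k x\<bar> \<le> 2^k * (d k x)\<^sup>2 + (1/2)^k"
        by (subst (asm) mult_le_cancel_left_pos) auto
      then show "norm (d k x) \<le> 2^k * (d k x)\<^sup>2 + (1/2)^k" by simp
    qed
    then have "convergent (\<lambda>k. \<Sum>j<k. d j x)" by (simp add: summable_iff_convergent)
    moreover have "(\<Sum>j<k. d j x) = s k x - s 0 x" for k
      unfolding d_def by (rule sum_lessThan_telescope)
    ultimately have "convergent (\<lambda>k. s k x - s 0 x)" by simp
    then have "convergent (\<lambda>k. (s k x - s 0 x) + s 0 x)" by (intro convergent_add convergent_const)
    then show ?case by simp
  qed
  define T where "T x = lim (\<lambda>k. s k x)" for x
  have T_meas[measurable]: "T \<in> borel_measurable M"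
    unfolding T_def by (rule borel_measurable_lim_metric) simp
  have lim: "AE x in M. (\<lambda>k. s k x) \<longlonglongrightarrow> T x"
    using conv by eventually_elim (simp add: T_def convergent_LIMSEQ_iff)
  \<comment> \<open>Fatou's lemma in k carries the bound for \<open>s k - s j\<close> over to the
    limit, and at the same time shows that \<open>T\<close> is square integrable. The arbitrary
    values of \<open>lim\<close> at points of divergence lie in a null set.\<close>
  have nn_T: "(\<integral>\<^sup>+x. ennreal ((T x - s j x)\<^sup>2) \<partial>M) \<le> ennreal ((1/4)^j)" for j
  proof -
    have "(\<integral>\<^sup>+x. ennreal ((T x - s j x)\<^sup>2) \<partial>M)
        = (\<integral>\<^sup>+x. liminf (\<lambda>k. ennreal ((s k x - s j x)\<^sup>2)) \<partial>M)"
    proof (rule nn_integral_cong_AE, use lim in eventually_elim)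
      case (elim x)
      then have "(\<lambda>k. ennreal ((s k x - s j x)\<^sup>2)) \<longlonglongrightarrow> ennreal ((T x - s j x)\<^sup>2)"
        by (intro tendsto_intros)
      then show ?case by (rule lim_imp_Liminf[OF sequentially_bot, symmetric])
    qed
    also have "\<dots> \<le> liminf (\<lambda>k. \<integral>\<^sup>+x. ennreal ((s k x - s j x)\<^sup>2) \<partial>M)"
      by (intro nn_integral_liminf) auto
    also have "\<dots> \<le> ennreal ((1/4)^j)"
    proof (rule Liminf_le)
      show "\<forall>\<^sub>F k in sequentially. (\<integral>\<^sup>+x. ennreal ((s k x - s j x)\<^sup>2) \<partial>M) \<le> ennreal ((1/4)^j)"
        using eventually_ge_at_top[of j]
      proof eventually_elim
        case (elim k)
        have "(\<integral>\<^sup>+x. ennreal ((s k x - s j x)\<^sup>2) \<partial>M) = ennreal (\<integral>x. (s k x - s j x)\<^sup>2 \<partial>M)"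
          using sq_integrable_square[OF sq_integrable_diff[OF s_int s_int]]
          by (intro nn_integral_eq_integral) auto
        then show ?case using sdist[OF elim] by (simp add: ennreal_leI)
      qed
    qed simp
    finally show ?thesis .
  qed
  have Ts: "sq_integrable M (\<lambda>x. T x - s j x)" for j
    unfolding sq_integrable_def
    using nn_T[of j] by (auto simp: integrable_iff_bounded intro: le_less_trans)
  have T_int: "sq_integrable M T"
    using sq_integrable_add[OF Ts s_int, of 0 0] by simp
  have Tdist: "(\<integral>x. (T x - s j x)\<^sup>2 \<partial>M) \<le> (1/4)^j" for j
  proof -
    have "ennreal (\<integral>x. (T x - s j x)\<^sup>2 \<partial>M) = (\<integral>\<^sup>+x. ennreal ((T x - s j x)\<^sup>2) \<partial>M)"
      using sq_integrable_square[OF Ts] by (intro nn_integral_eq_integral[symmetric]) auto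
    then have "ennreal (\<integral>x. (T x - s j x)\<^sup>2 \<partial>M) \<le> ennreal ((1/4)^j)"
      using nn_T[of j] by (simp only:)
    then show ?thesis by (subst (asm) ennreal_le_iff) simp_all
  qed
  have quarter: "(\<lambda>j. (1/4::real)^j) \<longlonglongrightarrow> 0" by (rule LIMSEQ_power_zero) simp
  have Te: "(\<integral>x. T x * e n x \<partial>M) = c n" for n
  proof -
    have "((\<integral>x. T x * e n x \<partial>M) - c n)\<^sup>2 \<le> (1/4)^j" if "j > n" for j
    proof -
      have "n \<in> {..<r j}" using rN(2)[of j] that by simp
      then have "c n = (\<integral>x. s j x * e n x \<partial>M)"
        using Se[of "{..<r j}" n] by (simp add: s_def)
      then have "(\<integral>x. T x * e n x \<partial>M) - c n = (\<integral>x. (T x - s j x) * e n x \<partial>M)"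
        using sq_integrable_mult[OF T_int e] sq_integrable_mult[OF s_int e]
        by (simp add: left_diff_distrib)
      then have "((\<integral>x. T x * e n x \<partial>M) - c n)\<^sup>2
          \<le> (\<integral>x. (T x - s j x)\<^sup>2 \<partial>M) * (\<integral>x. (e n x)\<^sup>2 \<partial>M)"
        using integral_Cauchy_Schwarz[OF Ts e] by simp
      also have "(\<integral>x. (e n x)\<^sup>2 \<partial>M) = 1"
        using orth[of n n] by (simp add: power2_eq_square)
      finally show ?thesis using Tdist[of j] by simp
    qed
    then have "((\<integral>x. T x * e n x \<partial>M) - c n)\<^sup>2 \<le> 0"
      by (intro tendsto_lowerbound[OF quarter]) (auto intro: eventually_mono[OF eventually_gt_at_top[of n]])
    then show ?thesis by simp
  qed
  have "AE x in M. h x - T x = 0"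
  proof (rule total)
    show "sq_integrable M (\<lambda>x. h x - T x)" by (intro sq_integrable_diff h T_int)
    show "(\<integral>x. (h x - T x) * e n x \<partial>M) = 0" for n
      using sq_integrable_mult[OF T_int e] Te[of n] by (simp add: left_diff_distrib c_def)
  qed
  then have "(\<integral>x. (h x - s j x)\<^sup>2 \<partial>M) = (\<integral>x. (T x - s j x)\<^sup>2 \<partial>M)" for j
    using h by (intro integral_cong_AE) (auto simp: sq_integrable_def)
  then have hs: "(\<integral>x. (h x)\<^sup>2 \<partial>M) - (\<Sum>n<r j. (c n)\<^sup>2) \<le> (1/4)^j" for j
    using Tdist[of j] hS[of "{..<r j}"] by (simp add: s_def)
  have "(\<integral>x. (h x)\<^sup>2 \<partial>M) \<le> (\<Sum>n. (c n)\<^sup>2) + (1/4)^j" for j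
    using hs[of j] sum_le_suminf[OF summ, of "{..<r j}"] by simp
  then have "(\<integral>x. (h x)\<^sup>2 \<partial>M) \<le> (\<Sum>n. (c n)\<^sup>2) + 0"
    by (intro tendsto_lowerbound[OF tendsto_add[OF tendsto_const quarter]]) auto
  moreover have "(\<Sum>n. (c n)\<^sup>2) \<le> (\<integral>x. (h x)\<^sup>2 \<partial>M)"
    by (rule suminf_le_const[OF summ]) (simp add: bessel)
  ultimately show ?thesis
    using summable_sums[OF summ] by (simp add: c_def)
qed


section \<open>Determinacy by moments under exponential integrability\<close>

text \<open>Because \<open>exp_int\<close> holds for every c, it dominates the partial sums of the
  power series of exp (i t x) for every real t. So the Fourier transform of \<psi> is the series of
  its moments for all t, not just near 0, and vanishes identically without any analytic
  continuation; Levy's uniqueness theorem finishes.\<close>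

lemma null_moments_imp_AE_zero_borel:
  fixes \<psi> :: "real \<Rightarrow> real"
  assumes meas[measurable]: "\<psi> \<in> borel_measurable lborel"
    and exp_int: "\<And>c. integrable lborel (\<lambda>x. \<bar>\<psi> x\<bar> * exp (c * \<bar>x\<bar>))"
    and moments: "\<And>k. (\<integral>x. \<psi> x * x ^ k \<partial>lborel) = 0"
  shows "AE x in lborel. \<psi> x = 0"
proof -
  have int: "integrable lborel \<psi>"
    using exp_int[of 0] by (simp add: integrable_abs_iff)
  have pow_int: "integrable lborel (\<lambda>x. \<psi> x * x ^ k)" for k
  proof (rule Bochner_Integration.integrable_bound[OF integrable_mult_left[OF exp_int[of 1], of "fact k"]])
    have "\<bar>x\<bar> ^ k \<le> exp \<bar>x\<bar> * fact k" for x :: real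
    proof -
      have "\<bar>x\<bar> ^ k / fact k \<le> exp \<bar>x\<bar>"
        using sum_le_suminf[OF summable_exp[of "\<bar>x\<bar>"], of "{k}"]
        by (simp add: exp_def divide_inverse mult.commute)
      then show ?thesis by (simp add: divide_simps)
    qed
    then show "AE x in lborel. norm (\<psi> x * x ^ k) \<le> norm (\<bar>\<psi> x\<bar> * exp (1 * \<bar>x\<bar>) * fact k)"
      by (auto simp: abs_mult power_abs mult.assoc intro!: AE_I2 mult_left_mono)
  qed auto
  have fourier: "(\<integral>x. complex_of_real (\<psi> x) * iexp (t * x) \<partial>lborel) = 0" for t
  proof -
    define s where "s N x = (\<Sum>k<N. (\<i> * t) ^ k / fact k * complex_of_real (\<psi> x * x ^ k))" for N and x :: real
    have "(\<lambda>N. \<integral>x. s N x \<partial>lborel) \<longlonglongrightarrow> (\<integral>x. complex_of_real (\<psi> x) * iexp (t * x) \<partial>lborel)"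
    proof (rule integral_dominated_convergence[where w = "\<lambda>x. \<bar>\<psi> x\<bar> * exp (\<bar>t\<bar> * \<bar>x\<bar>)"])
      have eq: "s N x = complex_of_real (\<psi> x) * (\<Sum>k<N. (\<i> * (t * x)) ^ k /\<^sub>R fact k)" for N x
        unfolding s_def sum_distrib_left
        by (intro sum.cong) (auto simp: scaleR_conv_of_real field_simps)
      show "AE x in lborel. (\<lambda>N. s N x) \<longlonglongrightarrow> complex_of_real (\<psi> x) * iexp (t * x)"
        unfolding eq using exp_converges[of "\<i> * (t * x)" for x]
        by (intro AE_I2 tendsto_mult tendsto_const) (simp add: sums_def)
      show "AE x in lborel. norm (s N x) \<le> \<bar>\<psi> x\<bar> * exp (\<bar>t\<bar> * \<bar>x\<bar>)" for N
      proof (rule AE_I2)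
        fix x :: real
        have "norm (\<Sum>k<N. (\<i> * (t * x)) ^ k /\<^sub>R fact k) \<le> (\<Sum>k<N. (\<bar>t\<bar> * \<bar>x\<bar>) ^ k /\<^sub>R fact k)"
          by (rule norm_sum[THEN order_trans]) (simp add: norm_power norm_mult abs_mult divide_inverse)
        also have "\<dots> \<le> exp (\<bar>t\<bar> * \<bar>x\<bar>)"
          using sum_le_suminf[OF summable_exp_generic[of "\<bar>t\<bar> * \<bar>x\<bar>"], of "{..<N}"] by (simp add: exp_def)
        finally show "norm (s N x) \<le> \<bar>\<psi> x\<bar> * exp (\<bar>t\<bar> * \<bar>x\<bar>)"
          unfolding eq norm_mult by (intro mult_mono) auto
      qed
      show "s N \<in> borel_measurable lborel" for N
        unfolding s_def by measurable
      show "(\<lambda>x. complex_of_real (\<psi> x) * iexp (t * x)) \<in> borel_measurable lborel"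
        by measurable
      show "integrable lborel (\<lambda>x. \<bar>\<psi> x\<bar> * exp (\<bar>t\<bar> * \<bar>x\<bar>))" by (rule exp_int)
    qed
    moreover have "(\<integral>x. s N x \<partial>lborel) = 0" for N
    proof -
      have "(\<integral>x. s N x \<partial>lborel)
          = (\<Sum>k<N. \<integral>x. (\<i> * t) ^ k / fact k * complex_of_real (\<psi> x * x ^ k) \<partial>lborel)"
        unfolding s_def using pow_int
        by (intro Bochner_Integration.integral_sum integrable_mult_right integrable_of_real)
      also have "\<dots> = (\<Sum>k<N. (\<i> * t) ^ k / fact k * complex_of_real (\<integral>x. \<psi> x * x ^ k \<partial>lborel))"
        by (simp only: integral_mult_right_zero integral_complex_of_real)
      finally show ?thesis by (simp add: moments)
    qed
    ultimately show ?thesis by (simp add: LIMSEQ_const_iff)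
  qed
  \<comment> \<open>After normalisation, the positive and negative part of \<open>\<psi>\<close> are densities with equal
    characteristic functions.\<close>
  define p n where "p x = max 0 (\<psi> x)" and "n x = max 0 (- \<psi> x)" for x
  have [measurable]: "p \<in> borel_measurable lborel" "n \<in> borel_measurable lborel"
    unfolding p_def n_def by measurable
  have pn_int: "integrable lborel p" "integrable lborel n"
    using int unfolding p_def n_def by auto
  have pn: "p x - n x = \<psi> x" "p x \<ge> 0" "n x \<ge> 0" for x
    by (auto simp: p_def n_def)
  define c where "c = (\<integral>x. p x \<partial>lborel)"
  have c_n: "c = (\<integral>x. n x \<partial>lborel)"
  proof -
    have "(\<integral>x. p x - n x \<partial>lborel) = 0" using moments[of 0] by (simp add: pn)
    then show ?thesis using pn_int by (simp add: c_def)
  qed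
  have c_nonneg: "c \<ge> 0" by (simp add: c_def pn)
  show ?thesis
  proof (cases "c = 0")
    case True
    then have "AE x in lborel. p x = 0" "AE x in lborel. n x = 0"
      using integral_nonneg_eq_0_iff_AE[OF pn_int(1)] integral_nonneg_eq_0_iff_AE[OF pn_int(2)] pn c_n
      by (auto simp: c_def)
    then show ?thesis by eventually_elim (metis pn(1) diff_zero)
  next
    case False
    with c_nonneg have c: "c > 0" by simp
    define P where "P u = density lborel (\<lambda>x. ennreal (u x / c))" for u :: "real \<Rightarrow> real"
    have dist: "real_distribution (P u)"
      if [measurable]: "u \<in> borel_measurable lborel" and u: "\<And>x. u x \<ge> 0" "integrable lborel u" "(\<integral>x. u x \<partial>lborel) = c" for u
    proof -
      have "(\<integral>\<^sup>+x. ennreal (u x / c) \<partial>lborel) = ennreal (\<integral>x. u x / c \<partial>lborel)"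
        using u c by (intro nn_integral_eq_integral) auto
      then have "prob_space (P u)"
        using u c by (intro prob_spaceI) (simp add: P_def emeasure_density)
      then show ?thesis
        by (simp add: real_distribution_def real_distribution_axioms_def P_def)
    qed
    have char: "char (P u) t = (\<integral>x. complex_of_real (u x) * iexp (t * x) \<partial>lborel) / c"
      if [measurable]: "u \<in> borel_measurable lborel" and u: "\<And>x. u x \<ge> 0" for u t
    proof -
      have "char (P u) t = (\<integral>x. (u x / c) *\<^sub>R iexp (t * x) \<partial>lborel)"
        unfolding char_def P_def using u c by (intro integral_density) auto
      also have "\<dots> = (\<integral>x. complex_of_real (u x) * iexp (t * x) / c \<partial>lborel)"
        by (intro Bochner_Integration.integral_cong) (auto simp: scaleR_conv_of_real)
      finally show ?thesis by simp
    qed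
    have iexp_int: "integrable lborel (\<lambda>x. complex_of_real (u x) * iexp (t * x))"
      if "integrable lborel u" for u :: "real \<Rightarrow> real" and t
      by (rule Bochner_Integration.integrable_bound[OF that]) (use that in \<open>auto simp: norm_mult\<close>)
    have "char (P p) = char (P n)"
    proof
      fix t
      have "(\<integral>x. complex_of_real (p x) * iexp (t * x) - complex_of_real (n x) * iexp (t * x) \<partial>lborel) = 0"
        using fourier[of t] by (simp add: pn flip: left_diff_distrib of_real_diff)
      then show "char (P p) t = char (P n) t"
        using iexp_int[OF pn_int(1), of t] iexp_int[OF pn_int(2), of t] by (simp add: char pn)
    qed
    then have "P p = P n"
      by (intro Levy_uniqueness dist) (use pn pn_int c_n in \<open>auto simp: c_def\<close>)
    then have "AE x in lborel. ennreal (p x / c) = ennreal (n x / c)"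
      unfolding P_def by (subst (asm) sigma_finite_measure.density_unique_iff[OF sigma_finite_lborel]) auto
    then show ?thesis
    proof eventually_elim
      case (elim x)
      then have "p x / c = n x / c" using pn c by (subst (asm) ennreal_inj) auto
      then show ?case using c pn(1)[of x] by simp
    qed
  qed
qed

text \<open>Levy's theorem concerns distributions on Borel sets, while the weighted spaces consist
  of Lebesgue measurable functions. A Borel function equal to \<psi> almost everywhere carries the
  result over.\<close>

lemma null_moments_imp_AE_zero:
  fixes \<psi> :: "real \<Rightarrow> real"
  assumes meas: "\<psi> \<in> borel_measurable lebesgue"
    and exp_int: "\<And>c. integrable lebesgue (\<lambda>x. \<bar>\<psi> x\<bar> * exp (c * \<bar>x\<bar>))"
    and moments: "\<And>k. (\<integral>x. \<psi> x * x ^ k \<partial>lebesgue) = 0"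
  shows "AE x in lebesgue. \<psi> x = 0"
proof -
  obtain \<psi>' where [measurable]: "\<psi>' \<in> borel_measurable lborel" and "AE x in lborel. \<psi> x = \<psi>' x"
    using completion_ex_borel_measurable_real[OF meas] by blast
  then have ae: "AE x in lebesgue. \<psi> x = \<psi>' x"
    by (intro AE_completion)
  have m: "f \<in> borel_measurable lborel \<Longrightarrow> f \<in> borel_measurable lebesgue" for f :: "real \<Rightarrow> real"
    by (rule measurable_completion)
  have "AE x in lborel. \<psi>' x = 0"
  proof (rule null_moments_imp_AE_zero_borel)
    fix c
    have "integrable lebesgue (\<lambda>x. \<bar>\<psi>' x\<bar> * exp (c * \<bar>x\<bar>))"
    proof (rule integrable_cong_AE_imp[OF exp_int[of c]])
      show "(\<lambda>x. \<bar>\<psi>' x\<bar> * exp (c * \<bar>x\<bar>)) \<in> borel_measurable lebesgue" by (rule m) measurable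
      show "AE x in lebesgue. \<bar>\<psi> x\<bar> * exp (c * \<bar>x\<bar>) = \<bar>\<psi>' x\<bar> * exp (c * \<bar>x\<bar>)"
        using ae by eventually_elim simp
    qed
    then show "integrable lborel (\<lambda>x. \<bar>\<psi>' x\<bar> * exp (c * \<bar>x\<bar>))"
      by (subst (asm) integrable_completion) auto
  next
    fix k
    have "(\<integral>x. \<psi> x * x ^ k \<partial>lebesgue) = (\<integral>x. \<psi>' x * x ^ k \<partial>lebesgue)"
    proof (rule integral_cong_AE)
      show "(\<lambda>x. \<psi> x * x ^ k) \<in> borel_measurable lebesgue"
        by (intro borel_measurable_times meas m) measurable
      show "(\<lambda>x. \<psi>' x * x ^ k) \<in> borel_measurable lebesgue" by (rule m) measurable
      show "AE x in lebesgue. \<psi> x * x ^ k = \<psi>' x * x ^ k"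
        using ae by eventually_elim simp
    qed
    also have "\<dots> = (\<integral>x. \<psi>' x * x ^ k \<partial>lborel)"
      by (intro integral_completion) measurable
    finally show "(\<integral>x. \<psi>' x * x ^ k \<partial>lborel) = 0" by (simp add: moments)
  qed measurable
  then have "AE x in lebesgue. \<psi>' x = 0" by (rule AE_completion)
  with ae show ?thesis by eventually_elim simp
qed

section \<open>Hermite polynomials in the weighted space\<close>

locale gaussian_weight =
  fixes \<alpha> :: real
  assumes \<alpha>_pos: "0 < \<alpha>"
begin

definition gauss :: "real \<Rightarrow> real" where
  "gauss x = sqrt (\<alpha> / (2 * pi)) * exp (- (x\<^sup>2 / 2) * \<alpha>)"

text \<open>Division by the root of \<open>gauss\<close> is the isometry from the weighted space
  onto unweighted square integrable functions. It sends p times \<open>gauss\<close> to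
  \<open>wpoly p\<close>, and in the product of the two images the roots cancel, so pairing with
  \<open>wpoly p\<close> is exactly \<open>moment\<close>.\<close>

definition normed :: "(real \<Rightarrow> real) \<Rightarrow> real \<Rightarrow> real" where
  "normed \<phi> x = \<phi> x / sqrt (gauss x)"

definition wpoly :: "real poly \<Rightarrow> real \<Rightarrow> real" where
  "wpoly p x = poly p x * sqrt (gauss x)"

definition weighted :: "(real \<Rightarrow> real) \<Rightarrow> bool" where
  "weighted \<phi> \<longleftrightarrow> sq_integrable lebesgue (normed \<phi>)"

definition weighted_norm_sq :: "(real \<Rightarrow> real) \<Rightarrow> real" where
  "weighted_norm_sq \<phi> = (\<integral>x. (normed \<phi> x)\<^sup>2 \<partial>lebesgue)"

definition poly_norm_sq :: "real poly \<Rightarrow> real" where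
  "poly_norm_sq p = (\<integral>x. (wpoly p x)\<^sup>2 \<partial>lebesgue)"

definition moment :: "(real \<Rightarrow> real) \<Rightarrow> real poly \<Rightarrow> real" where
  "moment \<phi> p = (\<integral>x. \<phi> x * poly p x \<partial>lebesgue)"

definition gauss_integral :: "real poly \<Rightarrow> real" where
  "gauss_integral p = (\<integral>x. poly p x * gauss x \<partial>lborel)"

text \<open>The recurrence applies the raising operator x - (1 / \<alpha>) d/dx, the adjoint of (1 /
  \<alpha>) d/dx for the Gaussian of variance 1 / \<alpha>; orthogonality is then a matter of
  integration by parts.\<close>

primrec hermite :: "nat \<Rightarrow> real poly" where
  "hermite 0 = 1"
| "hermite (Suc n) = [:0, 1:] * hermite n - smult (1 / \<alpha>) (pderiv (hermite n))"

section \<open>Gaussian integrals of polynomials\<close>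

lemma gauss_eq_normal_density: "gauss x = normal_density 0 (1 / sqrt \<alpha>) x"
  using \<alpha>_pos by (simp add: gauss_def normal_density_def power_divide field_simps real_sqrt_divide)

lemma gauss_pos: "gauss x > 0"
  using \<alpha>_pos by (simp add: gauss_def)

lemma gauss_continuous: "continuous_on S gauss"
  unfolding gauss_def by (intro continuous_intros) auto

lemma borel_measurable_gauss [measurable]: "gauss \<in> borel_measurable borel"
  by (intro borel_measurable_continuous_onI gauss_continuous)

lemma borel_measurable_poly [measurable]: "poly p \<in> borel_measurable borel" for p :: "real poly"
  by (intro borel_measurable_continuous_onI continuous_intros)

lemma borel_measurable_wpoly [measurable]: "wpoly p \<in> borel_measurable borel"
  unfolding wpoly_def by measurable

lemma borel_imp_lebesgue: "f \<in> borel_measurable borel \<Longrightarrow> f \<in> borel_measurable lebesgue"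
  for f :: "real \<Rightarrow> real"
  by (rule measurable_completion) simp

lemma gauss_moment_integrable: "integrable lborel (\<lambda>x. c * x ^ k * gauss x)"
  using integrable_mult_right[OF integrable_normal_moment[of "1 / sqrt \<alpha>" 0 k], of c] \<alpha>_pos
  by (simp add: gauss_eq_normal_density mult_ac)

lemma gauss_poly_integrable: "integrable lborel (\<lambda>x. poly p x * gauss x)"
  unfolding poly_altdef sum_distrib_right
  by (intro Bochner_Integration.integrable_sum gauss_moment_integrable)

lemma gauss_integral_add: "gauss_integral (p + q) = gauss_integral p + gauss_integral q"
  using gauss_poly_integrable by (simp add: gauss_integral_def ring_distribs)

lemma gauss_integral_diff: "gauss_integral (p - q) = gauss_integral p - gauss_integral q"
  using gauss_poly_integrable by (simp add: gauss_integral_def ring_distribs)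

lemma gauss_integral_smult: "gauss_integral (smult c p) = c * gauss_integral p"
  by (simp add: gauss_integral_def mult.assoc)

lemma gauss_integral_1: "gauss_integral 1 = 1"
  using \<alpha>_pos by (simp add: gauss_integral_def gauss_eq_normal_density)

lemma gauss_integral_monom_odd: "gauss_integral (monom 1 (2 * j + 1)) = 0"
  using integral_normal_moment_odd[of "1 / sqrt \<alpha>" 0 j] \<alpha>_pos
  by (simp add: gauss_integral_def poly_monom gauss_eq_normal_density mult_ac)

lemma gauss_integral_monom_even: "gauss_integral (monom 1 (2 * j)) = fact (2 * j) / ((2 * \<alpha>) ^ j * fact j)"
  using integral_normal_moment_even[of "1 / sqrt \<alpha>" 0 j] \<alpha>_pos
  by (simp add: gauss_integral_def poly_monom gauss_eq_normal_density mult_ac power_divide)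

text \<open>Integration by parts for x^k, read off the explicit normal moments: for even k both
  sides are zero, for odd k consecutive even moments have ratio k / \<alpha>. At k = 0 the monomial
  on the left has coefficient 0, so the truncated \<open>k - 1\<close> is harmless.\<close>

lemma gauss_integral_monom_rec: "gauss_integral (monom (real k) (k - 1)) = \<alpha> * gauss_integral (monom 1 (k + 1))"
proof (cases "even k")
  case True
  show ?thesis
  proof (cases "k = 0")
    case True
    then show ?thesis using gauss_integral_monom_odd[of 0] gauss_integral_smult[of 0 0] by simp
  next
    case False
    with True obtain j where k: "k = 2 * j + 2"
      by (metis add_2_eq_Suc' evenE mult_Suc_right not0_implies_Suc mult_0_right add.commute)
    show ?thesis
      using gauss_integral_monom_odd[of j] gauss_integral_monom_odd[of "Suc j"] gauss_integral_smult[of "real k" "monom 1 (2 * j + 1)"]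
      by (simp add: k smult_monom)
  qed
next
  case False
  then obtain j where k: "k = 2 * j + 1" by (elim oddE)
  have fact: "(fact (2 * Suc j) :: real) = (2 * real j + 2) * (2 * real j + 1) * fact (2 * j)"
    by (simp add: algebra_simps)
  have lower: "gauss_integral (monom (real k) (k - 1)) = (2 * real j + 1) * (fact (2 * j) / ((2 * \<alpha>) ^ j * fact j))"
    using gauss_integral_monom_even[of j] gauss_integral_smult[of "real k" "monom 1 (2 * j)"] by (simp add: k smult_monom)
  have upper: "gauss_integral (monom 1 (k + 1))
      = (2 * real j + 2) * (2 * real j + 1) * fact (2 * j) / (2 * \<alpha> * (2 * \<alpha>) ^ j * ((real j + 1) * fact j))"
    using gauss_integral_monom_even[of "Suc j"] unfolding fact by (simp add: k add.commute)
  have "(2 * real j + 1) * (F / (P * f))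
      = \<alpha> * ((2 * real j + 2) * (2 * real j + 1) * F / (2 * \<alpha> * P * ((real j + 1) * f)))"
    if "P > 0" "f > 0" for F P f :: real
    using \<alpha>_pos that by (simp add: divide_simps)
  from this[of "(2 * \<alpha>) ^ j" "fact j" "fact (2 * j)"] show ?thesis
    unfolding lower upper using \<alpha>_pos by simp
qed

text \<open>This is Stein's identity. Extending it linearly from monomials avoids any discussion of
  boundary terms at infinity.\<close>

lemma gauss_integral_pderiv: "gauss_integral (pderiv p) = \<alpha> * gauss_integral ([:0, 1:] * p)"
proof -
  have "gauss_integral (pderiv (\<Sum>i\<in>I. monom (coeff p i) i)) = \<alpha> * gauss_integral ([:0, 1:] * (\<Sum>i\<in>I. monom (coeff p i) i))"
    if "finite I" for I
    using that
  proof induction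
    case empty
    show ?case using gauss_integral_smult[of 0 0] by simp
  next
    case (insert i I)
    have "gauss_integral (pderiv (monom (coeff p i) i)) = coeff p i * gauss_integral (monom (real i) (i - 1))"
      by (simp add: pderiv_monom smult_monom mult.commute flip: gauss_integral_smult)
    also have "\<dots> = \<alpha> * (coeff p i * gauss_integral (monom 1 (i + 1)))"
      by (simp only: gauss_integral_monom_rec mult.left_commute)
    also have "coeff p i * gauss_integral (monom 1 (i + 1)) = gauss_integral ([:0, 1:] * monom (coeff p i) i)"
      by (simp add: smult_monom monom_Suc flip: gauss_integral_smult)
    finally show ?case
      using insert by (simp add: pderiv_add gauss_integral_add ring_distribs del: mult_pCons_left)
  qed
  from this[of "{..degree p}"] show ?thesis
    by (simp only: poly_as_sum_of_monoms finite_atMost)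
qed

section \<open>Hermite polynomials: derivative, recurrence, orthogonality\<close>

text \<open>The Appell property: by the induction hypothesis the differentiated recurrence contains
  n + 1 copies of the recurrence one degree lower, and the product rule contributes one
  more.\<close>

lemma pderiv_hermite: "pderiv (hermite (Suc n)) = of_nat (Suc n) * hermite n"
proof (induction n)
  case (Suc n)
  have "pderiv (hermite (Suc (Suc n)))
      = hermite (Suc n) + [:0, 1:] * pderiv (hermite (Suc n)) - smult (1 / \<alpha>) (pderiv (pderiv (hermite (Suc n))))"
    by (subst hermite.simps(2), simp only: pderiv_diff pderiv_mult pderiv_smult pderiv_pCons pderiv_0) simp
  also have "\<dots> = hermite (Suc n) + of_nat (Suc n) * hermite (Suc n)"
  proof -
    have "pderiv (of_nat (Suc n) * hermite n) = of_nat (Suc n) * pderiv (hermite n)"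
      by (simp only: pderiv_mult pderiv_of_nat mult_zero_left mult_zero_right add_0_right add_0_left mult.commute)
    then show ?thesis
      unfolding Suc.IH by (simp del: of_nat_Suc add: algebra_simps smult_diff_right)
  qed
  finally show ?case by (simp add: ring_distribs del: hermite.simps)
qed (simp add: pderiv_pCons)

lemma poly_pderiv_hermite: "poly (pderiv (hermite n)) x = real n * poly (hermite (n - 1)) x"
  by (cases n) (simp_all add: pderiv_hermite of_nat_poly del: hermite.simps(2))

lemma x_hermite: "x * poly (hermite n) x = poly (hermite (Suc n)) x + real n / \<alpha> * poly (hermite (n - 1)) x"
  by (simp add: poly_pderiv_hermite)

lemma gauss_integral_hermite_Suc: "gauss_integral (hermite (Suc n) * r) = gauss_integral (hermite n * pderiv r) / \<alpha>"
proof -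
  have "smult \<alpha> (hermite (Suc n) * r) = smult \<alpha> ([:0, 1:] * (hermite n * r)) - pderiv (hermite n) * r"
    using \<alpha>_pos by (simp add: algebra_simps smult_diff_right)
  then have "\<alpha> * gauss_integral (hermite (Suc n) * r) = gauss_integral (pderiv (hermite n * r)) - gauss_integral (pderiv (hermite n) * r)"
    by (metis gauss_integral_pderiv gauss_integral_diff gauss_integral_smult)
  also have "\<dots> = gauss_integral (hermite n * pderiv r)"
    by (simp add: pderiv_mult gauss_integral_add mult.commute)
  finally show ?thesis using \<alpha>_pos by (simp add: field_simps)
qed

text \<open>Each use of adjointness lowers both indices by one at the price of a factor n /
  \<alpha>, until one polynomial is constant. The derivative of the constant makes all unequal pairs
  vanish, and the collected factors give n! / \<alpha>^n.\<close>

lemma hermite_orthogonal: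
  "gauss_integral (hermite m * hermite n) = (if m = n then fact n / \<alpha> ^ n else 0)"
proof (induction m arbitrary: n)
  case 0
  show ?case
  proof (cases n)
    case (Suc k)
    then show ?thesis using gauss_integral_hermite_Suc[of k 1] gauss_integral_smult[of 0 0] by (simp del: hermite.simps(2))
  qed (simp add: gauss_integral_1)
next
  case (Suc m)
  show ?case
  proof (cases n)
    case 0
    then show ?thesis using gauss_integral_hermite_Suc[of m 1] gauss_integral_smult[of 0 0] by (simp del: hermite.simps(2))
  next
    case n: (Suc k)
    have "gauss_integral (hermite (Suc m) * hermite n) = real (Suc k) * gauss_integral (hermite m * hermite k) / \<alpha>"
      using gauss_integral_smult[of "real (Suc k)" "hermite m * hermite k"]
      by (simp only: n gauss_integral_hermite_Suc pderiv_hermite of_nat_poly mult_smult_right)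
        (simp add: of_nat_poly)
    then show ?thesis using \<alpha>_pos by (simp add: n Suc.IH del: hermite.simps)
  qed
qed

section \<open>The weighted space and its moments\<close>

lemma wpoly_square: "(wpoly p x)\<^sup>2 = poly (p * p) x * gauss x"
  using gauss_pos[of x] by (simp add: wpoly_def power_mult_distrib power2_eq_square less_imp_le)

lemma wpoly_mult: "wpoly p x * wpoly q x = poly (p * q) x * gauss x"
  using gauss_pos[of x] by (simp add: wpoly_def less_imp_le)

lemma wpoly_sq_integrable: "sq_integrable lebesgue (wpoly p)"
  unfolding sq_integrable_def wpoly_square
  using gauss_poly_integrable[of "p * p"]
  by (auto intro: borel_imp_lebesgue simp: integrable_completion)

lemma normed_mult_wpoly: "normed \<phi> x * wpoly p x = \<phi> x * poly p x"
  using gauss_pos[of x] by (simp add: normed_def wpoly_def)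

lemma normed_square: "(normed \<phi> x)\<^sup>2 = (\<phi> x)\<^sup>2 * inverse (gauss x)"
  using gauss_pos[of x] by (simp add: normed_def power_divide divide_inverse power_mult_distrib power_inverse less_imp_le)

lemma normed_measurable: "normed \<phi> \<in> borel_measurable lebesgue \<longleftrightarrow> \<phi> \<in> borel_measurable lebesgue"
proof
  have [measurable]: "(\<lambda>x. sqrt (gauss x)) \<in> borel_measurable lebesgue"
    by (rule borel_imp_lebesgue) measurable
  assume [measurable]: "normed \<phi> \<in> borel_measurable lebesgue"
  have "(\<lambda>x. normed \<phi> x * sqrt (gauss x)) \<in> borel_measurable lebesgue" by measurable
  also have "(\<lambda>x. normed \<phi> x * sqrt (gauss x)) = \<phi>"
    using normed_mult_wpoly[of \<phi> _ 1] by (simp add: wpoly_def)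
  finally show "\<phi> \<in> borel_measurable lebesgue" .
next
  have [measurable]: "(\<lambda>x. sqrt (gauss x)) \<in> borel_measurable lebesgue"
    by (rule borel_imp_lebesgue) measurable
  assume [measurable]: "\<phi> \<in> borel_measurable lebesgue"
  show "normed \<phi> \<in> borel_measurable lebesgue"
    unfolding normed_def by measurable
qed

lemma weighted_measurable: "weighted \<phi> \<Longrightarrow> \<phi> \<in> borel_measurable lebesgue"
  using normed_measurable by (auto simp: weighted_def sq_integrable_def)

lemma weighted_mult_poly_integrable: "weighted \<phi> \<Longrightarrow> integrable lebesgue (\<lambda>x. \<phi> x * poly p x)"
  using sq_integrable_mult[OF _ wpoly_sq_integrable[of p], of "normed \<phi>"]
  by (simp add: weighted_def normed_mult_wpoly)

lemma normed_add: "normed (\<lambda>x. \<phi> x + \<psi> x) = (\<lambda>x. normed \<phi> x + normed \<psi> x)"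
  by (simp add: normed_def add_divide_distrib fun_eq_iff)

lemma normed_diff: "normed (\<lambda>x. \<phi> x - \<psi> x) = (\<lambda>x. normed \<phi> x - normed \<psi> x)"
  by (simp add: normed_def diff_divide_distrib fun_eq_iff)

lemma weighted_diff: "weighted \<phi> \<Longrightarrow> weighted \<psi> \<Longrightarrow> weighted (\<lambda>x. \<phi> x - \<psi> x)"
  by (auto simp: weighted_def normed_diff)

lemma normed_poly_gauss: "normed (\<lambda>x. poly p x * gauss x) = wpoly p"
proof
  fix x
  show "normed (\<lambda>x. poly p x * gauss x) x = wpoly p x"
    using gauss_pos[of x] by (simp add: normed_def wpoly_def field_simps)
qed

lemma weighted_poly_gauss: "weighted (\<lambda>x. poly p x * gauss x)"
  unfolding weighted_def normed_poly_gauss by (rule wpoly_sq_integrable)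

lemma poly_norm_sq_nonneg: "poly_norm_sq p \<ge> 0"
  by (simp add: poly_norm_sq_def)

lemma weighted_norm_sq_nonneg: "weighted_norm_sq p \<ge> 0"
  by (simp add: weighted_norm_sq_def)

lemma moment_poly_gauss: "moment (\<lambda>x. poly p x * gauss x) q = gauss_integral (p * q)"
  unfolding moment_def gauss_integral_def
  by (subst integral_completion) (simp_all add: mult_ac)

lemma moment_diff: "weighted \<phi> \<Longrightarrow> weighted \<psi> \<Longrightarrow> moment (\<lambda>x. \<phi> x - \<psi> x) p = moment \<phi> p - moment \<psi> p"
  unfolding moment_def using weighted_mult_poly_integrable by (simp add: left_diff_distrib)

lemma moment_bound: "weighted \<phi> \<Longrightarrow> (moment \<phi> p)\<^sup>2 \<le> weighted_norm_sq \<phi> * poly_norm_sq p"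
  using integral_Cauchy_Schwarz[OF _ wpoly_sq_integrable[of p], of "normed \<phi>"]
  by (simp add: weighted_def normed_mult_wpoly moment_def weighted_norm_sq_def poly_norm_sq_def)

text \<open>Half of the Gaussian exponent suffices for integrability; the other half absorbs 2 c |x|
  by completing the square, at the cost exp (4 c^2 / \<alpha>). The \<open>sqrt 2\<close> in
  \<open>K\<close> matches the normalising constants for \<alpha> and \<alpha> / 2.\<close>

lemma exp_abs_sq_integrable: "sq_integrable lebesgue (\<lambda>x. exp (c * \<bar>x\<bar>) * sqrt (gauss x))"
proof (rule sq_integrable_bound)
  interpret N: gaussian_weight "\<alpha> / 2" by standard (use \<alpha>_pos in simp)
  define K where "K = exp (4 * c\<^sup>2 / \<alpha>) * sqrt 2"
  have "integrable lborel (\<lambda>x. K * N.gauss x)"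
    using N.gauss_poly_integrable[of "[:K:]"] by simp
  then show "integrable lebesgue (\<lambda>x. K * N.gauss x)"
    by (simp add: integrable_completion)
  show "(\<lambda>x. exp (c * \<bar>x\<bar>) * sqrt (gauss x)) \<in> borel_measurable lebesgue"
    by (rule borel_imp_lebesgue) measurable
  show "(exp (c * \<bar>x\<bar>) * sqrt (gauss x))\<^sup>2 \<le> K * N.gauss x" for x
  proof -
    have "0 \<le> (4 * c - \<alpha> * \<bar>x\<bar>)\<^sup>2" by simp
    then have "2 * (4 * c) * (\<alpha> * \<bar>x\<bar>) \<le> 16 * c\<^sup>2 + \<alpha>\<^sup>2 * x\<^sup>2"
      by (simp add: power2_diff power_mult_distrib)
    then have "2 * c * \<bar>x\<bar> - x\<^sup>2 / 2 * \<alpha> \<le> 4 * c\<^sup>2 / \<alpha> - x\<^sup>2 / 2 * (\<alpha> / 2)"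
      using \<alpha>_pos by (simp add: field_simps power2_eq_square)
    then have "exp (2 * c * \<bar>x\<bar>) * exp (- (x\<^sup>2 / 2) * \<alpha>) \<le> exp (4 * c\<^sup>2 / \<alpha>) * exp (- (x\<^sup>2 / 2) * (\<alpha> / 2))"
      by (simp flip: exp_add)
    moreover have "sqrt (\<alpha> / (2 * pi)) = sqrt 2 * sqrt (\<alpha> / 2 / (2 * pi))"
      by (simp flip: real_sqrt_mult)
    moreover have "(exp (c * \<bar>x\<bar>) * sqrt (gauss x))\<^sup>2 = exp (2 * c * \<bar>x\<bar>) * gauss x"
      using gauss_pos[of x] by (simp add: power_mult_distrib flip: exp_double)
    ultimately show ?thesis
      unfolding K_def gauss_def N.gauss_def using \<alpha>_pos
      by (simp add: mult_left_mono mult_ac)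
  qed
qed

text \<open>Multiplication by x shifts the Hermite index both up and down, so the vanishing of the
  moments is proved for x^k times every \<open>hermite n\<close> simultaneously; n = 0 then gives
  the pure powers needed for determinacy.\<close>

lemma hermite_total:
  assumes \<phi>: "weighted \<phi>" and null: "\<And>n. moment \<phi> (hermite n) = 0"
  shows "AE x in lebesgue. \<phi> x = 0"
proof (rule null_moments_imp_AE_zero)
  show "\<phi> \<in> borel_measurable lebesgue" by (rule weighted_measurable[OF \<phi>])
  show "integrable lebesgue (\<lambda>x. \<bar>\<phi> x\<bar> * exp (c * \<bar>x\<bar>))" for c
  proof -
    have "integrable lebesgue (\<lambda>x. \<bar>normed \<phi> x * (exp (c * \<bar>x\<bar>) * sqrt (gauss x))\<bar>)"
      using \<phi> unfolding weighted_def by (intro integrable_abs sq_integrable_mult exp_abs_sq_integrable)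
    moreover have "\<bar>normed \<phi> x * (exp (c * \<bar>x\<bar>) * sqrt (gauss x))\<bar> = \<bar>\<phi> x\<bar> * exp (c * \<bar>x\<bar>)" for x
      using gauss_pos[of x] by (simp add: normed_def abs_mult)
    ultimately show ?thesis by simp
  qed
  have "moment \<phi> (monom 1 k * hermite n) = 0" for k n
  proof (induction k arbitrary: n)
    case 0
    then show ?case by (simp add: null)
  next
    case (Suc k)
    have "moment \<phi> (monom 1 (Suc k) * hermite n)
        = (\<integral>x. \<phi> x * poly (monom 1 k * hermite (Suc n)) x
             + real n / \<alpha> * (\<phi> x * poly (monom 1 k * hermite (n - 1)) x) \<partial>lebesgue)"
      unfolding moment_def
    proof (intro Bochner_Integration.integral_cong refl)
      fix x
      have "\<phi> x * poly (monom 1 (Suc k) * hermite n) x = \<phi> x * x ^ k * (x * poly (hermite n) x)"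
        by (simp add: poly_monom)
      then show "\<phi> x * poly (monom 1 (Suc k) * hermite n) x = \<phi> x * poly (monom 1 k * hermite (Suc n)) x
             + real n / \<alpha> * (\<phi> x * poly (monom 1 k * hermite (n - 1)) x)"
        unfolding x_hermite by (simp add: poly_monom algebra_simps del: hermite.simps)
    qed
    also have "\<dots> = moment \<phi> (monom 1 k * hermite (Suc n)) + real n / \<alpha> * moment \<phi> (monom 1 k * hermite (n - 1))"
      unfolding moment_def using weighted_mult_poly_integrable[OF \<phi>]
      by (subst Bochner_Integration.integral_add) (simp_all del: hermite.simps poly_mult)
    finally show ?case by (simp add: Suc.IH del: hermite.simps)
  qed
  from this[of _ 0] show "(\<integral>x. \<phi> x * x ^ k \<partial>lebesgue) = 0" for k
    by (simp add: moment_def poly_monom)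
qed

text \<open>The weight \<alpha>^n / n! is the reciprocal of the squared norm of
  \<open>hermite n\<close>, so its root \<open>s n\<close> normalises the sequence. Totality is
  pulled back through the isometry by taking \<psi> as h times the root of
  \<open>gauss\<close>.\<close>

theorem hermite_Parseval:
  assumes \<phi>: "weighted \<phi>"
  shows "(\<lambda>n. (moment \<phi> (hermite n))\<^sup>2 * (\<alpha> ^ n / fact n)) sums weighted_norm_sq \<phi>"
proof -
  define s where "s n = sqrt (\<alpha> ^ n / fact n)" for n
  have s: "s n > 0" "(s n)\<^sup>2 = \<alpha> ^ n / fact n" for n
    using \<alpha>_pos by (auto simp: s_def)
  define e where "e n x = s n * wpoly (hermite n) x" for n x
  have e: "sq_integrable lebesgue (e n)" for n
    unfolding e_def by (intro sq_integrable_cmult wpoly_sq_integrable)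
  have coef: "(\<integral>x. normed \<psi> x * e n x \<partial>lebesgue) = s n * moment \<psi> (hermite n)" for \<psi> n
    by (simp add: e_def moment_def mult.left_commute[of _ "s n"] normed_mult_wpoly)
  have orth: "(\<integral>x. e m x * e n x \<partial>lebesgue) = (if m = n then 1 else 0)" for m n
  proof -
    have "(\<integral>x. e m x * e n x \<partial>lebesgue) = s m * s n * gauss_integral (hermite m * hermite n)"
      unfolding e_def gauss_integral_def wpoly_mult
      by (subst integral_completion[symmetric]) (simp_all add: wpoly_mult mult_ac flip: poly_mult)
    also have "\<dots> = (if m = n then 1 else 0)"
      using s(2)[of n] \<alpha>_pos by (simp add: hermite_orthogonal power2_eq_square)
    finally show ?thesis .
  qed
  have "(\<lambda>n. (\<integral>x. normed \<phi> x * e n x \<partial>lebesgue)\<^sup>2) sums (\<integral>x. (normed \<phi> x)\<^sup>2 \<partial>lebesgue)"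
  proof (rule Parseval[OF e orth])
    show "sq_integrable lebesgue (normed \<phi>)" using \<phi> by (simp add: weighted_def)
    fix h assume h: "sq_integrable lebesgue h" "\<And>n. (\<integral>x. h x * e n x \<partial>lebesgue) = 0"
    define \<psi> where "\<psi> x = h x * sqrt (gauss x)" for x
    have n\<psi>: "normed \<psi> = h"
    proof
      fix x show "normed \<psi> x = h x" using gauss_pos[of x] by (simp add: normed_def \<psi>_def)
    qed
    have "AE x in lebesgue. \<psi> x = 0"
    proof (rule hermite_total)
      show "weighted \<psi>" using h by (simp add: weighted_def n\<psi>)
      show "moment \<psi> (hermite n) = 0" for n
        using h(2)[of n] coef[of \<psi> n] s(1)[of n] by (simp add: n\<psi>)
    qed
    then show "AE x in lebesgue. h x = 0"
      by eventually_elim (use gauss_pos in \<open>auto simp: \<psi>_def less_le\<close>)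
  qed
  then show ?thesis
    unfolding coef power_mult_distrib s weighted_norm_sq_def by (simp only: mult.commute)
qed

end

section \<open>Moments of solutions\<close>

lemma tendsto_zero_scaled_sqrt:
  fixes f g :: "'a \<Rightarrow> real"
  assumes "(f \<longlongrightarrow> 0) F" "\<And>x. (g x)\<^sup>2 \<le> f x * c"
  shows "(g \<longlongrightarrow> 0) F"
proof -
  have "((\<lambda>x. sqrt (f x * c)) \<longlongrightarrow> sqrt (0 * c)) F"
    by (intro tendsto_intros assms(1))
  then have "((\<lambda>x. sqrt (f x * c)) \<longlongrightarrow> 0) F" by simp
  then show ?thesis
    by (rule Lim_null_comparison[rotated]) (use assms(2) in \<open>auto intro!: always_eventually real_le_rsqrt\<close>)
qed

lemma C21_has_derivatives:
  assumes "C21 u" "t > 0"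
  shows "((\<lambda>s. u x s) has_real_derivative d_t u x t) (at t)"
    and "((\<lambda>y. u y t) has_real_derivative d_x u x t) (at x)"
    and "((\<lambda>y. d_x u y t) has_real_derivative d_x (d_x u) x t) (at x)"
  using assms unfolding C21_def d_t_def d_x_def
  by (auto simp: DERIV_deriv_iff_real_differentiable)

lemma C21_continuous_slice:
  assumes "C21 u" "t > 0"
  shows "continuous_on S (\<lambda>x. u x t)" "continuous_on S (\<lambda>x. d_t u x t)"
proof -
  show "continuous_on S (\<lambda>x. u x t)"
    using C21_has_derivatives(2)[OF assms]
    by (meson DERIV_isCont continuous_at_imp_continuous_on)
  have "continuous_on (UNIV \<times> {0<..}) (\<lambda>(x, t). d_t u x t)"
    using assms(1) by (simp add: C21_def)
  moreover have "continuous_on S (\<lambda>x. (x, t))"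
    by (intro continuous_intros)
  ultimately have "continuous_on S (\<lambda>x. case (x, t) of (x, t) \<Rightarrow> d_t u x t)"
    by (rule continuous_on_compose2) (use assms(2) in auto)
  then show "continuous_on S (\<lambda>x. d_t u x t)" by simp
qed

context gaussian_weight
begin

section \<open>Truncated moments and polynomial cut-offs\<close>

definition cut_moment :: "real \<Rightarrow> (real \<Rightarrow> real) \<Rightarrow> real poly \<Rightarrow> real" where
  "cut_moment R \<phi> p = (\<integral>x. indicator {-R..R} x * (\<phi> x * poly p x) \<partial>lebesgue)"

text \<open>The Ornstein-Uhlenbeck generator, the formal adjoint of the Fokker-Planck operator that
  maps \<phi> to (\<phi>' + \<alpha> x \<phi>)'.\<close>

definition generator :: "real poly \<Rightarrow> real poly" where
  "generator p = pderiv (pderiv p) - smult \<alpha> ([:0, 1:] * pderiv p)"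

text \<open>A polynomial cut-off, unlike a smooth bump, keeps the test functions polynomial. It
  equals 1 - 2 x^2 / R^2 + x^4 / R^4, hence differs from 1 by fixed polynomials with small
  coefficients.\<close>

definition cutoff :: "real \<Rightarrow> real poly" where
  "cutoff R = [:1, 0, - (1 / R\<^sup>2):]\<^sup>2"

lemma cut_moment_integrable:
  assumes "weighted \<phi>"
  shows "integrable lebesgue (\<lambda>x. indicator {-R..R} x * (\<phi> x * poly p x))"
  using integrable_mult_indicator[OF _ weighted_mult_poly_integrable[OF assms, of p], of "{-R..R}"] by simp

text \<open>Estimates use the Lebesgue form; the fundamental theorem of calculus and differentiation
  in time use the gauge integral.\<close>

lemma cut_moment_eq_integral:
  assumes "weighted \<phi>"
  shows "cut_moment R \<phi> p = integral {-R..R} (\<lambda>x. \<phi> x * poly p x)"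
proof -
  have "set_integrable lebesgue {-R..R} (\<lambda>x. \<phi> x * poly p x)"
    using cut_moment_integrable[OF assms] by (simp add: set_integrable_def)
  from set_lebesgue_integral_eq_integral(2)[OF this] show ?thesis
    by (simp add: cut_moment_def set_lebesgue_integral_def)
qed

lemma cut_moment_add: "weighted \<phi> \<Longrightarrow> cut_moment R \<phi> (p + q) = cut_moment R \<phi> p + cut_moment R \<phi> q"
  unfolding cut_moment_def using cut_moment_integrable by (simp add: ring_distribs)

lemma cut_moment_smult: "cut_moment R \<phi> (smult c p) = c * cut_moment R \<phi> p"
  by (simp add: cut_moment_def mult.left_commute[of _ c])

lemma abs_moment_bound:
  assumes "weighted \<phi>"
  shows "(\<integral>x. \<bar>\<phi> x * poly p x\<bar> \<partial>lebesgue) \<le> sqrt (weighted_norm_sq \<phi>) * sqrt (poly_norm_sq p)"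
proof -
  have abs: "sq_integrable M h \<Longrightarrow> sq_integrable M (\<lambda>x. \<bar>h x\<bar>)" for M and h :: "'a \<Rightarrow> real"
    by (auto simp: sq_integrable_def)
  have "(\<integral>x. \<bar>normed \<phi> x\<bar> * \<bar>wpoly p x\<bar> \<partial>lebesgue)\<^sup>2
      \<le> (\<integral>x. \<bar>normed \<phi> x\<bar>\<^sup>2 \<partial>lebesgue) * (\<integral>x. \<bar>wpoly p x\<bar>\<^sup>2 \<partial>lebesgue)"
    using assms unfolding weighted_def by (intro integral_Cauchy_Schwarz abs wpoly_sq_integrable)
  then have "(\<integral>x. \<bar>\<phi> x * poly p x\<bar> \<partial>lebesgue)\<^sup>2 \<le> weighted_norm_sq \<phi> * poly_norm_sq p"
    by (simp add: weighted_norm_sq_def poly_norm_sq_def normed_mult_wpoly flip: abs_mult)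
  then show ?thesis
    unfolding real_sqrt_mult[symmetric] by (rule real_le_rsqrt)
qed

lemma cut_moment_bound:
  assumes "weighted \<phi>"
  shows "\<bar>cut_moment R \<phi> p\<bar> \<le> sqrt (weighted_norm_sq \<phi>) * sqrt (poly_norm_sq p)"
proof -
  have "\<bar>cut_moment R \<phi> p\<bar> \<le> (\<integral>x. \<bar>indicator {-R..R} x * (\<phi> x * poly p x)\<bar> \<partial>lebesgue)"
    unfolding cut_moment_def by (rule integral_abs_bound)
  also have "\<dots> \<le> (\<integral>x. \<bar>\<phi> x * poly p x\<bar> \<partial>lebesgue)"
    using cut_moment_integrable[OF assms, of R p] weighted_mult_poly_integrable[OF assms, of p]
    by (intro integral_mono) (auto simp: indicator_def)
  finally show ?thesis using abs_moment_bound[OF assms, of p] by simp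
qed

text \<open>Outside [-R, R] the factor |x| / R is at least 1. Inserting it trades the tail for 1 / R
  and one more degree of the polynomial, whose norm is still finite.\<close>

lemma cut_moment_tail:
  assumes "weighted \<phi>" "R > 0"
  shows "\<bar>cut_moment R \<phi> p - moment \<phi> p\<bar> \<le> sqrt (weighted_norm_sq \<phi>) * sqrt (poly_norm_sq ([:0, 1:] * p)) / R"
proof -
  note int = cut_moment_integrable[OF assms(1), of R p] weighted_mult_poly_integrable[OF assms(1)]
  have "\<bar>cut_moment R \<phi> p - moment \<phi> p\<bar>
      = \<bar>\<integral>x. indicator {-R..R} x * (\<phi> x * poly p x) - \<phi> x * poly p x \<partial>lebesgue\<bar>"
    using int by (simp add: cut_moment_def moment_def)
  also have "\<dots> \<le> (\<integral>x. \<bar>indicator {-R..R} x * (\<phi> x * poly p x) - \<phi> x * poly p x\<bar> \<partial>lebesgue)"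
    by (rule integral_abs_bound)
  also have "\<dots> \<le> (\<integral>x. \<bar>\<phi> x * poly ([:0, 1:] * p) x\<bar> / R \<partial>lebesgue)"
  proof (rule integral_mono)
    show "integrable lebesgue (\<lambda>x. \<bar>indicator {-R..R} x * (\<phi> x * poly p x) - \<phi> x * poly p x\<bar>)"
      using int by (intro integrable_abs Bochner_Integration.integrable_diff)
    show "integrable lebesgue (\<lambda>x. \<bar>\<phi> x * poly ([:0, 1:] * p) x\<bar> / R)"
      using int(2)[of "[:0, 1:] * p"] by (intro integrable_divide_zero integrable_abs) auto
    show "\<bar>indicator {-R..R} x * (\<phi> x * poly p x) - \<phi> x * poly p x\<bar> \<le> \<bar>\<phi> x * poly ([:0, 1:] * p) x\<bar> / R" for x
    proof (cases "x \<in> {-R..R}")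
      case False
      then have "R \<le> \<bar>x\<bar>" by auto
      then have "\<bar>\<phi> x * poly p x\<bar> * R \<le> \<bar>\<phi> x * poly p x\<bar> * \<bar>x\<bar>"
        by (intro mult_left_mono) auto
      then show ?thesis using False assms(2) by (simp add: abs_mult field_simps)
    qed (use assms(2) in auto)
  qed
  also have "\<dots> = (\<integral>x. \<bar>\<phi> x * poly ([:0, 1:] * p) x\<bar> \<partial>lebesgue) / R"
    by simp
  also have "\<dots> \<le> sqrt (weighted_norm_sq \<phi>) * sqrt (poly_norm_sq ([:0, 1:] * p)) / R"
    by (intro divide_right_mono abs_moment_bound assms(1)) (use assms(2) in simp)
  finally show ?thesis .
qed

text \<open>What matters is that \<open>K\<close> depends on \<open>T\<close> and \<open>q\<close>
  but not on \<phi> or R, so the convergence is uniform over norm-bounded \<phi>. Linearity of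
  \<open>T\<close> isolates the two error polynomials \<open>q1\<close> and \<open>q2\<close> with
  prefactors 1 / R^2 and 1 / R^4, both at most 1 / R because R >= 1. The lemma serves for
  \<open>T\<close> the identity, \<open>generator\<close>, and p mapped to x p'.\<close>

lemma cutoff_limit:
  assumes add: "\<And>p q. T (p + q) = T p + T q" and smult: "\<And>c p. T (smult c p) = smult c (T p)"
  obtains K where "K \<ge> 0" "\<And>\<phi> R. weighted \<phi> \<Longrightarrow> R \<ge> 1 \<Longrightarrow>
    \<bar>cut_moment R \<phi> (T (q * cutoff R)) - moment \<phi> (T q)\<bar> \<le> sqrt (weighted_norm_sq \<phi>) * K / R"
proof
  define q1 q2 where "q1 = q * [:0, 0, -2:]" and "q2 = q * [:0, 0, 0, 0, 1:]"
  define K where "K = sqrt (poly_norm_sq ([:0, 1:] * T q)) + sqrt (poly_norm_sq (T q1)) + sqrt (poly_norm_sq (T q2))"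
  show "K \<ge> 0" by (simp add: K_def poly_norm_sq_nonneg)
  fix \<phi> and R :: real
  assume \<phi>: "weighted \<phi>" and R: "R \<ge> 1"
  have "cutoff R = 1 + smult (1 / R\<^sup>2) [:0, 0, -2:] + smult (1 / R^4) [:0, 0, 0, 0, 1:]"
    unfolding cutoff_def by (simp add: power2_eq_square one_pCons power4_eq_xxxx)
  then have "q * cutoff R = q + smult (1 / R\<^sup>2) q1 + smult (1 / R^4) q2"
    unfolding q1_def q2_def by (simp only: ring_distribs mult_smult_right mult_1_right)
  then have "cut_moment R \<phi> (T (q * cutoff R))
      = cut_moment R \<phi> (T q) + 1 / R\<^sup>2 * cut_moment R \<phi> (T q1) + 1 / R^4 * cut_moment R \<phi> (T q2)"
    using \<phi> by (simp add: add smult cut_moment_add cut_moment_smult)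
  moreover have "\<bar>1 / R^k * cut_moment R \<phi> p\<bar> \<le> sqrt (weighted_norm_sq \<phi>) * sqrt (poly_norm_sq p) / R" if "k \<ge> 1" for k p
  proof -
    have "R ^ 1 \<le> R ^ k" using R that by (intro power_increasing)
    then have "1 / R ^ k \<le> 1 / R" using R by (simp add: frac_le)
    then have "1 / R^k * \<bar>cut_moment R \<phi> p\<bar> \<le> 1 / R * (sqrt (weighted_norm_sq \<phi>) * sqrt (poly_norm_sq p))"
      using R by (intro mult_mono cut_moment_bound[OF \<phi>]) auto
    then show ?thesis using R by (simp add: abs_mult)
  qed
  from this[of 2 "T q1"] this[of 4 "T q2"]
  have "\<bar>1 / R\<^sup>2 * cut_moment R \<phi> (T q1)\<bar> \<le> sqrt (weighted_norm_sq \<phi>) * sqrt (poly_norm_sq (T q1)) / R"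
    "\<bar>1 / R^4 * cut_moment R \<phi> (T q2)\<bar> \<le> sqrt (weighted_norm_sq \<phi>) * sqrt (poly_norm_sq (T q2)) / R" by simp_all
  moreover have "\<bar>cut_moment R \<phi> (T q) - moment \<phi> (T q)\<bar> \<le> sqrt (weighted_norm_sq \<phi>) * sqrt (poly_norm_sq ([:0, 1:] * T q)) / R"
    using R by (intro cut_moment_tail \<phi>) auto
  moreover have "sqrt (weighted_norm_sq \<phi>) * K / R = sqrt (weighted_norm_sq \<phi>) * sqrt (poly_norm_sq ([:0, 1:] * T q)) / R
      + sqrt (weighted_norm_sq \<phi>) * sqrt (poly_norm_sq (T q1)) / R + sqrt (weighted_norm_sq \<phi>) * sqrt (poly_norm_sq (T q2)) / R"
    by (simp add: K_def algebra_simps add_divide_distrib)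
  ultimately show "\<bar>cut_moment R \<phi> (T (q * cutoff R)) - moment \<phi> (T q)\<bar> \<le> sqrt (weighted_norm_sq \<phi>) * K / R"
    by linarith
qed

lemma generator_add: "generator (p + q) = generator p + generator q"
  by (simp add: generator_def pderiv_add algebra_simps smult_add_right)

lemma generator_smult: "generator (smult c p) = smult c (generator p)"
  by (simp add: generator_def pderiv_smult smult_diff_right mult.commute)

lemma cutoff_boundary:
  assumes "R > 0" "x \<in> {-R, R}"
  shows "poly (q * cutoff R) x = 0" "poly (pderiv (q * cutoff R)) x = 0"
proof -
  define c where "c = [:1, 0, - (1 / R\<^sup>2):]"
  have c: "poly c x = 0" using assms by (auto simp: c_def power2_eq_square)
  have eq: "q * cutoff R = q * c * c" by (simp only: cutoff_def c_def power2_eq_square mult.assoc)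
  show "poly (q * cutoff R) x = 0" "poly (pderiv (q * cutoff R)) x = 0"
    unfolding eq by (simp_all add: c pderiv_mult)
qed

text \<open>The cut-off test polynomials vanish to second order at \<open>\<plusminus>R\<close>, so both integrations by parts
  on \<open>[-R, R]\<close> are free of boundary terms.\<close>

lemma weak_form:
  assumes u: "C21 u" and w: "C21 w" and t: "t > 0" and R: "R > 0"
    and eq: "\<And>x. d_t u x t = d_x (\<lambda>x t. d_x u x t + \<alpha> * x * u x t) x t + \<beta> * (x * d_x w x t + w x t)"
    and \<psi>: "\<psi> = q * cutoff R"
  shows "integral {-R..R} (\<lambda>x. d_t u x t * poly \<psi> x)
    = integral {-R..R} (\<lambda>x. u x t * poly (generator \<psi>) x)
      - \<beta> * integral {-R..R} (\<lambda>x. w x t * poly ([:0, 1:] * pderiv \<psi>) x)"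
proof -
  note du = C21_has_derivatives[OF u t] and dw = C21_has_derivatives[OF w t]
  note cont = C21_continuous_slice[OF u t] C21_continuous_slice[OF w t]
  have flux: "d_t u x t = d_x (d_x u) x t + \<alpha> * (u x t + x * d_x u x t) + \<beta> * (x * d_x w x t + w x t)" for x
  proof -
    have "((\<lambda>x. d_x u x t + \<alpha> * x * u x t) has_real_derivative
        d_x (d_x u) x t + \<alpha> * (u x t + x * d_x u x t)) (at x)"
      by (rule derivative_eq_intros du refl | simp add: algebra_simps)+
    then have "d_x (\<lambda>x t. d_x u x t + \<alpha> * x * u x t) x t = d_x (d_x u) x t + \<alpha> * (u x t + x * d_x u x t)"
      by (simp add: d_x_def[of "\<lambda>x t. d_x u x t + \<alpha> * x * u x t"] DERIV_imp_deriv)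
    with eq show ?thesis by simp
  qed
  \<comment> \<open>The source is itself a divergence, \<beta> (x w' + w) = (\<beta> x w)', so it
    joins the flux in a single antiderivative and the derivative of w disappears from the weak
    form.\<close>
  define \<Phi> where "\<Phi> x = (d_x u x t + \<alpha> * x * u x t + \<beta> * x * w x t) * poly \<psi> x - u x t * poly (pderiv \<psi>) x" for x
  have d\<Phi>: "(\<Phi> has_real_derivative d_t u x t * poly \<psi> x -
      (u x t * poly (generator \<psi>) x - \<beta> * (w x t * poly ([:0, 1:] * pderiv \<psi>) x))) (at x)" for x
    unfolding \<Phi>_def flux generator_def
    by (rule derivative_eq_intros du dw poly_DERIV refl | simp add: algebra_simps)+
  have "-R \<le> R" using R by simp
  then have "((\<lambda>x. d_t u x t * poly \<psi> x -
      (u x t * poly (generator \<psi>) x - \<beta> * (w x t * poly ([:0, 1:] * pderiv \<psi>) x))) has_integral \<Phi> R - \<Phi> (-R)) {-R..R}"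
    by (rule fundamental_theorem_of_calculus)
      (rule has_vector_derivative_at_within[OF d\<Phi>[unfolded has_real_derivative_iff_has_vector_derivative]])
  moreover have "\<Phi> R = 0" "\<Phi> (-R) = 0"
    using cutoff_boundary[OF R, of R q] cutoff_boundary[OF R, of "-R" q] by (simp_all add: \<Phi>_def \<psi>)
  ultimately have "integral {-R..R} (\<lambda>x. d_t u x t * poly \<psi> x -
      (u x t * poly (generator \<psi>) x - \<beta> * (w x t * poly ([:0, 1:] * pderiv \<psi>) x))) = 0"
    by (simp add: integral_unique)
  moreover have int: "(\<lambda>x. d_t u x t * poly \<psi> x) integrable_on {-R..R}"
    "(\<lambda>x. u x t * poly (generator \<psi>) x) integrable_on {-R..R}"
    "(\<lambda>x. w x t * poly ([:0, 1:] * pderiv \<psi>) x) integrable_on {-R..R}"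
    by (intro integrable_continuous_interval continuous_intros cont)+
  moreover note bw = int(3)[THEN integrable_on_mult_right, of \<beta>]
  ultimately show ?thesis
    using integral_diff[OF int(1) integrable_diff[OF int(2) bw]] integral_diff[OF int(2) bw]
    by (simp only: integral_mult_right)
qed

lemma integral_has_time_derivative:
  assumes u: "C21 u" and t: "t > 0"
  shows "((\<lambda>s. integral {-R..R} (\<lambda>x. u x s * poly p x)) has_real_derivative
    integral {-R..R} (\<lambda>x. d_t u x t * poly p x)) (at t)"
proof -
  have "((\<lambda>s. integral (cbox (-R) R) (\<lambda>x. u x s * poly p x)) has_real_derivative
    integral (cbox (-R) R) (\<lambda>x. d_t u x t * poly p x)) (at t within {0<..})"
  proof (rule leibniz_rule_field_derivative[where fx = "\<lambda>s x. d_t u x s * poly p x"])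
    show "((\<lambda>s. u x s * poly p x) has_real_derivative d_t u x s * poly p x) (at s within {0<..})"
      if "s \<in> {0<..}" for s x
      using that by (intro DERIV_cmult_right has_field_derivative_at_within[OF C21_has_derivatives(1)[OF u]]) auto
    show "(\<lambda>x. u x s * poly p x) integrable_on cbox (-R) R" if "s \<in> {0<..}" for s
      using that by (intro integrable_continuous continuous_intros C21_continuous_slice[OF u]) auto
    have "continuous_on (UNIV \<times> {0<..}) (\<lambda>(x, t). d_t u x t)"
      using u by (simp add: C21_def)
    moreover have "continuous_on ({0<..} \<times> cbox (-R) R) (\<lambda>y. (snd y, fst y))"
      by (intro continuous_intros)
    ultimately have "continuous_on ({0<..} \<times> cbox (-R) R) (\<lambda>y. case (snd y, fst y) of (x, t) \<Rightarrow> d_t u x t)"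
      by (rule continuous_on_compose2) auto
    then have "continuous_on ({0<..} \<times> cbox (-R) R) (\<lambda>y. d_t u (snd y) (fst y))"
      by simp
    then show "continuous_on ({0<..} \<times> cbox (-R) R) (\<lambda>(s, x). d_t u x s * poly p x)"
      unfolding case_prod_beta by (intro continuous_intros)
  qed (use t in auto)
  moreover have "at t within {0<..} = at t" using t by (intro at_within_open) auto
  ultimately show ?thesis by simp
qed

section \<open>Moments along norm-continuous curves\<close>

lemma weighted_norm_sq_add_le:
  assumes "weighted \<phi>" "weighted \<psi>"
  shows "weighted_norm_sq (\<lambda>x. \<phi> x + \<psi> x) \<le> 2 * weighted_norm_sq \<phi> + 2 * weighted_norm_sq \<psi>"
proof -
  note sq = assms[unfolded weighted_def]
  have "weighted_norm_sq (\<lambda>x. \<phi> x + \<psi> x) \<le> (\<integral>x. 2 * (normed \<phi> x)\<^sup>2 + 2 * (normed \<psi> x)\<^sup>2 \<partial>lebesgue)"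
    unfolding weighted_norm_sq_def normed_add
    using sq_integrable_square[OF sq_integrable_add[OF sq]] sq_integrable_square[OF sq(1)] sq_integrable_square[OF sq(2)]
    by (intro integral_mono) (auto intro: square_add_le)
  also have "\<dots> = 2 * weighted_norm_sq \<phi> + 2 * weighted_norm_sq \<psi>"
    unfolding weighted_norm_sq_def using sq_integrable_square[OF sq(1)] sq_integrable_square[OF sq(2)] by simp
  finally show ?thesis .
qed

definition L2_curve :: "(real \<Rightarrow> real \<Rightarrow> real) \<Rightarrow> bool" where
  "L2_curve u \<longleftrightarrow> (\<forall>t\<ge>0. weighted (\<lambda>x. u x t)) \<and>
     (\<forall>t\<ge>0. ((\<lambda>s. weighted_norm_sq (\<lambda>x. u x s - u x t)) \<longlongrightarrow> 0) (at t within {0..}))"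

lemma L2_curve_weighted: "L2_curve u \<Longrightarrow> t \<ge> 0 \<Longrightarrow> weighted (\<lambda>x. u x t)"
  by (simp add: L2_curve_def)

text \<open>A single bound for all times near t makes the cut-off errors uniform there. The 2 under
  the root in \<open>B\<close> comes from continuity at t with tolerance 1.\<close>

lemma L2_curve_locally_bounded:
  assumes u: "L2_curve u" and t: "t > 0"
  obtains B where "B \<ge> 0" "\<forall>\<^sub>F s in nhds t. sqrt (weighted_norm_sq (\<lambda>x. u x s)) \<le> B"
proof
  define B where "B = sqrt (2 + 2 * weighted_norm_sq (\<lambda>x. u x t))"
  show "B \<ge> 0" by (simp add: B_def weighted_norm_sq_nonneg)
  have "at t within {0..} = at t" using t by (intro at_within_interior) auto
  then have "((\<lambda>s. weighted_norm_sq (\<lambda>x. u x s - u x t)) \<longlongrightarrow> 0) (at t)"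
    using u t unfolding L2_curve_def by (metis less_imp_le)
  then have "\<forall>\<^sub>F s in at t. weighted_norm_sq (\<lambda>x. u x s - u x t) < 1"
    by (rule order_tendstoD) simp
  moreover have "weighted_norm_sq (\<lambda>x. u x t - u x t) < 1" by (simp add: weighted_norm_sq_def normed_def)
  ultimately have "\<forall>\<^sub>F s in nhds t. weighted_norm_sq (\<lambda>x. u x s - u x t) < 1"
    by (simp add: eventually_nhds_conv_at)
  moreover have "\<forall>\<^sub>F s in nhds t. s > 0"
    using eventually_nhds_in_open[of "{0<..}" t] t by simp
  ultimately show "\<forall>\<^sub>F s in nhds t. sqrt (weighted_norm_sq (\<lambda>x. u x s)) \<le> B"
  proof eventually_elim
    case (elim s)
    note wt = L2_curve_weighted[OF u]
    have "weighted_norm_sq (\<lambda>x. (u x s - u x t) + u x t) \<le> 2 * weighted_norm_sq (\<lambda>x. u x s - u x t) + 2 * weighted_norm_sq (\<lambda>x. u x t)"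
      using elim t by (intro weighted_norm_sq_add_le weighted_diff wt) auto
    then show ?case using elim by (simp add: B_def)
  qed
qed

lemma moment_continuous:
  assumes u: "L2_curve u"
  shows "continuous_on {0..} (\<lambda>t. moment (\<lambda>x. u x t) p)"
  unfolding continuous_on_def
proof (intro ballI)
  fix t :: real assume t: "t \<in> {0..}"
  \<comment> \<open>For negative s nothing is known about the curve. The value 0 makes the quadratic
    bound hold for all s, and the filter within {0..} does not see the change.\<close>
  define d where "d s = (if s \<ge> 0 then moment (\<lambda>x. u x s) p - moment (\<lambda>x. u x t) p else 0)" for s
  have "(d \<longlongrightarrow> 0) (at t within {0..})"
  proof (rule tendsto_zero_scaled_sqrt)
    show "((\<lambda>s. weighted_norm_sq (\<lambda>x. u x s - u x t)) \<longlongrightarrow> 0) (at t within {0..})"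
      using u t by (simp add: L2_curve_def)
    show "(d s)\<^sup>2 \<le> weighted_norm_sq (\<lambda>x. u x s - u x t) * poly_norm_sq p" for s
    proof (cases "s \<ge> 0")
      case True
      then have wt: "weighted (\<lambda>x. u x s)" "weighted (\<lambda>x. u x t)"
        using t by (auto intro: L2_curve_weighted[OF u])
      show ?thesis using moment_bound[OF weighted_diff[OF wt], of p] True by (simp add: d_def moment_diff wt)
    qed (simp add: d_def weighted_norm_sq_nonneg poly_norm_sq_nonneg)
  qed
  then have "((\<lambda>s. moment (\<lambda>x. u x s) p - moment (\<lambda>x. u x t) p) \<longlongrightarrow> 0) (at t within {0..})"
    by (rule Lim_transform_eventually) (auto simp: d_def eventually_at_filter)
  then show "((\<lambda>s. moment (\<lambda>x. u x s) p) \<longlongrightarrow> moment (\<lambda>x. u x t) p) (at t within {0..})"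
    by (rule LIM_zero_cancel)
qed

text \<open>Time derivatives are taken on bounded intervals, where joint continuity suffices. As the
  interval grows, the cut moments converge and their derivatives converge uniformly near t, so the
  limit may be differentiated. The choice \<beta> = 0, w = u covers the first equation.\<close>

lemma moment_has_derivative:
  assumes u: "L2_curve u" "C21 u" and w: "L2_curve w" "C21 w" and t: "t > 0"
    and eq: "\<And>x t. t > 0 \<Longrightarrow>
      d_t u x t = d_x (\<lambda>x t. d_x u x t + \<alpha> * x * u x t) x t + \<beta> * (x * d_x w x t + w x t)"
  shows "((\<lambda>s. moment (\<lambda>x. u x s) q) has_real_derivative
    moment (\<lambda>x. u x t) (generator q) - \<beta> * moment (\<lambda>x. w x t) ([:0, 1:] * pderiv q)) (at t)"
proof -
  obtain Bu where Bu: "Bu \<ge> 0" "\<forall>\<^sub>F s in nhds t. sqrt (weighted_norm_sq (\<lambda>x. u x s)) \<le> Bu"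
    using L2_curve_locally_bounded[OF u(1) t] .
  obtain Bw where Bw: "Bw \<ge> 0" "\<forall>\<^sub>F s in nhds t. sqrt (weighted_norm_sq (\<lambda>x. w x s)) \<le> Bw"
    using L2_curve_locally_bounded[OF w(1) t] .
  have "\<forall>\<^sub>F s in nhds t. s > 0"
    using eventually_nhds_in_open[of "{0<..}" t] t by simp
  with Bu(2) Bw(2)
  have "\<forall>\<^sub>F s in nhds t. s > 0 \<and> sqrt (weighted_norm_sq (\<lambda>x. u x s)) \<le> Bu \<and> sqrt (weighted_norm_sq (\<lambda>x. w x s)) \<le> Bw"
    by eventually_elim simp
  then obtain r where r: "r > 0" and
    near: "\<And>s. s \<in> ball t r \<Longrightarrow> s > 0 \<and> sqrt (weighted_norm_sq (\<lambda>x. u x s)) \<le> Bu \<and> sqrt (weighted_norm_sq (\<lambda>x. w x s)) \<le> Bw"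
    unfolding eventually_nhds_metric by (auto simp: dist_commute)
  obtain K0 where K0: "K0 \<ge> 0" "\<And>\<phi> R. weighted \<phi> \<Longrightarrow> R \<ge> 1 \<Longrightarrow>
      \<bar>cut_moment R \<phi> (q * cutoff R) - moment \<phi> q\<bar> \<le> sqrt (weighted_norm_sq \<phi>) * K0 / R"
    by (rule cutoff_limit[of "\<lambda>p. p" q]) auto
  obtain K1 where K1: "K1 \<ge> 0" "\<And>\<phi> R. weighted \<phi> \<Longrightarrow> R \<ge> 1 \<Longrightarrow>
      \<bar>cut_moment R \<phi> (generator (q * cutoff R)) - moment \<phi> (generator q)\<bar> \<le> sqrt (weighted_norm_sq \<phi>) * K1 / R"
    by (rule cutoff_limit[of generator q]) (auto simp: generator_add generator_smult)
  obtain K2 where K2: "K2 \<ge> 0" "\<And>\<phi> R. weighted \<phi> \<Longrightarrow> R \<ge> 1 \<Longrightarrow>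
      \<bar>cut_moment R \<phi> ([:0, 1:] * pderiv (q * cutoff R)) - moment \<phi> ([:0, 1:] * pderiv q)\<bar> \<le> sqrt (weighted_norm_sq \<phi>) * K2 / R"
    by (rule cutoff_limit[of "\<lambda>p. [:0, 1:] * pderiv p" q])
      (auto simp: pderiv_add pderiv_smult ring_distribs)
  define m where "m n s = integral {-real (Suc n)..real (Suc n)} (\<lambda>x. u x s * poly (q * cutoff (real (Suc n))) x)" for n s
  define D where "D n s = cut_moment (real (Suc n)) (\<lambda>x. u x s) (generator (q * cutoff (real (Suc n))))
      - \<beta> * cut_moment (real (Suc n)) (\<lambda>x. w x s) ([:0, 1:] * pderiv (q * cutoff (real (Suc n))))" for n s
  define D0 where "D0 s = moment (\<lambda>x. u x s) (generator q) - \<beta> * moment (\<lambda>x. w x s) ([:0, 1:] * pderiv q)" for s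
  have wt: "weighted (\<lambda>x. u x s)" "weighted (\<lambda>x. w x s)" if "s \<in> ball t r" for s
    using near[OF that] by (auto intro: L2_curve_weighted u w)
  have m_lim: "(\<lambda>n. m n s) \<longlonglongrightarrow> moment (\<lambda>x. u x s) q" if s: "s \<in> ball t r" for s
  proof -
    have "(\<lambda>n. m n s - moment (\<lambda>x. u x s) q) \<longlonglongrightarrow> 0"
    proof (rule Lim_null_comparison)
      show "\<forall>\<^sub>F n in sequentially. norm (m n s - moment (\<lambda>x. u x s) q) \<le> sqrt (weighted_norm_sq (\<lambda>x. u x s)) * K0 * (1 / real (Suc n))"
      proof (intro always_eventually allI)
        show "norm (m n s - moment (\<lambda>x. u x s) q) \<le> sqrt (weighted_norm_sq (\<lambda>x. u x s)) * K0 * (1 / real (Suc n))" for n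
          using K0(2)[OF wt(1)[OF s], of "real (Suc n)"]
          unfolding m_def cut_moment_eq_integral[OF wt(1)[OF s]] by simp
      qed
      show "(\<lambda>n. sqrt (weighted_norm_sq (\<lambda>x. u x s)) * K0 * (1 / real (Suc n))) \<longlonglongrightarrow> 0"
        using tendsto_mult[OF tendsto_const LIMSEQ_inverse_real_of_nat] by (simp add: inverse_eq_divide)
    qed
    then show ?thesis by (rule LIM_zero_cancel)
  qed
  have m_deriv: "(m n has_real_derivative D n s) (at s)" if s: "s \<in> ball t r" for n s
  proof -
    have "s > 0" using near[OF s] by simp
    have "(m n has_real_derivative
        integral {-real (Suc n)..real (Suc n)} (\<lambda>x. d_t u x s * poly (q * cutoff (real (Suc n))) x)) (at s)"
      unfolding m_def by (rule integral_has_time_derivative[OF u(2) \<open>s > 0\<close>])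
    also have "integral {-real (Suc n)..real (Suc n)} (\<lambda>x. d_t u x s * poly (q * cutoff (real (Suc n))) x) = D n s"
      unfolding D_def cut_moment_eq_integral[OF wt(1)[OF s]] cut_moment_eq_integral[OF wt(2)[OF s]]
      by (rule weak_form[OF u(2) w(2) \<open>s > 0\<close> _ eq[OF \<open>s > 0\<close>] refl]) simp
    finally show ?thesis .
  qed
  \<comment> \<open>The right-hand side is free of s because \<open>Bu\<close> and \<open>Bw\<close>
    hold on the whole ball; this is the uniformity that the limit theorem below requires.\<close>
  have D_bound: "\<bar>D n s - D0 s\<bar> \<le> (Bu * K1 + \<bar>\<beta>\<bar> * (Bw * K2)) * (1 / real (Suc n))" if s: "s \<in> ball t r" for n s
  proof -
    define a1 a2 where "a1 = cut_moment (real (Suc n)) (\<lambda>x. u x s) (generator (q * cutoff (real (Suc n)))) - moment (\<lambda>x. u x s) (generator q)"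
      and "a2 = cut_moment (real (Suc n)) (\<lambda>x. w x s) ([:0, 1:] * pderiv (q * cutoff (real (Suc n)))) - moment (\<lambda>x. w x s) ([:0, 1:] * pderiv q)"
    have "\<bar>a1\<bar> \<le> sqrt (weighted_norm_sq (\<lambda>x. u x s)) * K1 / real (Suc n)"
      unfolding a1_def by (rule K1(2)[OF wt(1)[OF s]]) simp
    also have "\<dots> \<le> Bu * K1 / real (Suc n)"
      using near[OF s] K1(1) by (intro divide_right_mono mult_right_mono) auto
    finally have 1: "\<bar>a1\<bar> \<le> Bu * K1 / real (Suc n)" .
    have "\<bar>a2\<bar> \<le> sqrt (weighted_norm_sq (\<lambda>x. w x s)) * K2 / real (Suc n)"
      unfolding a2_def by (rule K2(2)[OF wt(2)[OF s]]) simp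
    also have "\<dots> \<le> Bw * K2 / real (Suc n)"
      using near[OF s] K2(1) by (intro divide_right_mono mult_right_mono) auto
    finally have 2: "\<bar>\<beta> * a2\<bar> \<le> \<bar>\<beta>\<bar> * (Bw * K2 / real (Suc n))"
      unfolding abs_mult by (intro mult_left_mono) auto
    have "D n s - D0 s = a1 - \<beta> * a2"
      by (simp add: D_def D0_def a1_def a2_def algebra_simps)
    then have "\<bar>D n s - D0 s\<bar> \<le> \<bar>a1\<bar> + \<bar>\<beta> * a2\<bar>" by linarith
    also have "\<dots> \<le> Bu * K1 / real (Suc n) + \<bar>\<beta>\<bar> * (Bw * K2 / real (Suc n))"
      using 1 2 by linarith
    also have "\<dots> = (Bu * K1 + \<bar>\<beta>\<bar> * (Bw * K2)) * (1 / real (Suc n))"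
      by (simp add: add_divide_distrib)
    finally show ?thesis .
  qed
  have "\<exists>g. \<forall>s\<in>ball t r. (\<lambda>n. m n s) \<longlonglongrightarrow> g s \<and> (g has_derivative (*) (D0 s)) (at s within ball t r)"
  proof (rule has_derivative_sequence[where f' = "\<lambda>n s. (*) (D n s)" and ?x0.0 = t and l = "moment (\<lambda>x. u x t) q"])
    show "(m n has_derivative (*) (D n s)) (at s within ball t r)" if "s \<in> ball t r" for n s
      using m_deriv[OF that] by (simp add: has_field_derivative_def has_derivative_at_withinI)
    show "t \<in> ball t r" using r by simp
    then show "(\<lambda>n. m n t) \<longlonglongrightarrow> moment (\<lambda>x. u x t) q" by (rule m_lim)
    fix \<epsilon> :: real assume "\<epsilon> > 0"
    have "(\<lambda>n. (Bu * K1 + \<bar>\<beta>\<bar> * (Bw * K2)) * (1 / real (Suc n))) \<longlonglongrightarrow> 0"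
      using tendsto_mult[OF tendsto_const LIMSEQ_inverse_real_of_nat] by (simp add: inverse_eq_divide)
    then have "\<forall>\<^sub>F n in sequentially. (Bu * K1 + \<bar>\<beta>\<bar> * (Bw * K2)) * (1 / real (Suc n)) < \<epsilon>"
      using \<open>\<epsilon> > 0\<close> by (rule order_tendstoD)
    then show "\<forall>\<^sub>F n in sequentially. \<forall>s\<in>ball t r. \<forall>h. norm (D n s * h - D0 s * h) \<le> \<epsilon> * norm h"
    proof eventually_elim
      case (elim n)
      show ?case
      proof (intro ballI allI)
        fix s h :: real assume s: "s \<in> ball t r"
        have "norm (D n s * h - D0 s * h) = \<bar>D n s - D0 s\<bar> * \<bar>h\<bar>"
          by (simp flip: left_diff_distrib abs_mult)
        also have "\<dots> \<le> \<epsilon> * \<bar>h\<bar>"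
          using D_bound[OF s, of n] elim by (intro mult_right_mono) auto
        finally show "norm (D n s * h - D0 s * h) \<le> \<epsilon> * norm h" by simp
      qed
    qed
  qed simp
  then obtain g where g: "\<And>s. s \<in> ball t r \<Longrightarrow> (\<lambda>n. m n s) \<longlonglongrightarrow> g s"
    "\<And>s. s \<in> ball t r \<Longrightarrow> (g has_derivative (*) (D0 s)) (at s within ball t r)" by blast
  have "t \<in> ball t r" using r by simp
  then have "(g has_derivative (*) (D0 t)) (at t)"
    using g(2)[of t] by (simp add: at_within_open[OF _ open_ball])
  then have "((\<lambda>s. moment (\<lambda>x. u x s) q) has_derivative (*) (D0 t)) (at t)"
    by (rule has_derivative_transform_within_open[OF _ open_ball \<open>t \<in> ball t r\<close>])
      (use g(1) m_lim in \<open>blast intro: LIMSEQ_unique\<close>)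
  then show ?thesis by (simp add: has_field_derivative_def D0_def)
qed

text \<open>The Hermite polynomials are the eigenfunctions of the generator, which is why the moment
  equations decouple apart from the source.\<close>

lemma generator_hermite: "generator (hermite n) = smult (- \<alpha> * real n) (hermite n)"
proof (cases n)
  case (Suc k)
  have "pderiv (hermite n) = smult (real n) (hermite k)"
    by (simp only: Suc pderiv_hermite of_nat_poly) simp
  then have "generator (hermite n) = smult (real n) (pderiv (hermite k)) - smult (\<alpha> * real n) ([:0, 1:] * hermite k)"
    by (simp add: generator_def pderiv_smult)
  also have "\<dots> = smult (- \<alpha> * real n) (hermite n)"
    using \<alpha>_pos by (intro poly_eqI) (simp add: Suc field_simps coeff_pCons del: of_nat_Suc split: nat.split)
  finally show ?thesis .
qed (simp add: generator_def)

lemma moment_smult: "moment \<phi> (smult c p) = c * moment \<phi> p"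
  by (simp add: moment_def mult.left_commute[of _ c])

text \<open>The truncated subtractions are harmless, since \<open>n (n - 1)\<close> vanishes for \<open>n < 2\<close>.\<close>

lemma moment_x_pderiv_hermite:
  assumes "weighted \<phi>"
  shows "moment \<phi> ([:0, 1:] * pderiv (hermite n))
    = real n * moment \<phi> (hermite n) + real n * real (n - 1) / \<alpha> * moment \<phi> (hermite (n - 2))"
proof -
  have "x * poly (pderiv (hermite n)) x
      = real n * poly (hermite n) x + real n * real (n - 1) / \<alpha> * poly (hermite (n - 2)) x" for x
  proof (cases n)
    case (Suc k)
    then show ?thesis
      using x_hermite[of x k] 
      by (simp add: poly_pderiv_hermite mult.left_commute[of x] ring_distribs add_divide_distrib numeral_2_eq_2 del: hermite.simps)
  qed simp
  then have "moment \<phi> ([:0, 1:] * pderiv (hermite n)) =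
      (\<integral>x. real n * (\<phi> x * poly (hermite n) x) + real n * real (n - 1) / \<alpha> * (\<phi> x * poly (hermite (n - 2)) x) \<partial>lebesgue)"
    unfolding moment_def by (intro Bochner_Integration.integral_cong) (auto simp: algebra_simps)
  then show ?thesis
    unfolding moment_def using weighted_mult_poly_integrable[OF assms] by simp
qed

end

section \<open>Decay for a fixed parameter\<close>

text \<open>For y in [0, 1] the term y^k is the smallest of 1, y, ..., y^k, so k + 1 copies of it
  are at most the geometric sum, which telescopes against 1 - y.\<close>

lemma power_mult_diff_le_one:
  assumes "0 \<le> y" "y \<le> (1::real)"
  shows "real (Suc k) * (y ^ k * (1 - y)) \<le> 1"
proof -
  have "real (Suc k) * y ^ k = (\<Sum>j\<le>k. y ^ k)" by simp
  also have "\<dots> \<le> (\<Sum>j\<le>k. y ^ j)"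
    using assms by (intro sum_mono power_decreasing) auto
  finally have "real (Suc k) * y ^ k * (1 - y) \<le> (\<Sum>j\<le>k. y ^ j) * (1 - y)"
    using assms by (intro mult_right_mono) auto
  also have "\<dots> = 1 - y ^ Suc k"
    using sum_gp_basic[of y k] by (simp add: mult.commute)
  also have "\<dots> \<le> 1" using assms by simp
  finally show ?thesis by (simp add: mult.assoc)
qed

text \<open>Degree 1 has no spare power of y and accounts for t^2. For n >= 2 one spare power turns
  \<alpha> t into at most 1 - y, by exp (\<alpha> t) >= 1 + \<alpha> t. The remaining n y^(n - 2) (1
  - y) is at most 2 because n <= 2 (n - 1), which accounts for 4 / \<alpha>^2.\<close>

lemma linear_growth_decay_bound:
  fixes \<alpha> t :: real
  assumes "\<alpha> > 0" "t \<ge> 0" "n \<ge> 1"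
  defines "y \<equiv> exp (- \<alpha> * t)"
  shows "(real n * t * y ^ n)\<^sup>2 \<le> (t\<^sup>2 + 4 / \<alpha>\<^sup>2) * y\<^sup>2"
proof -
  have y: "0 < y" "y \<le> 1" using assms by (auto simp: y_def)
  consider "n = 1" | k where "n = Suc (Suc k)"
    using assms(3) by (metis One_nat_def Suc_le_D le_SucE le_zero_eq not0_implies_Suc)
  then have "(real n * t * y ^ (n - 1))\<^sup>2 \<le> t\<^sup>2 + 4 / \<alpha>\<^sup>2"
  proof cases
    case 1
    then show ?thesis by simp
  next
    case (2 k)
    have "y * (1 + \<alpha> * t) \<le> y * exp (\<alpha> * t)"
      using y exp_ge_add_one_self[of "\<alpha> * t"] by (intro mult_left_mono) auto
    then have 1: "\<alpha> * t * y \<le> 1 - y"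
      by (simp add: y_def algebra_simps flip: exp_add)
    have "\<alpha> * (real n * t * y ^ (n - 1)) = real n * y ^ k * (\<alpha> * t * y)"
      by (simp add: 2)
    also have "\<dots> \<le> real n * y ^ k * (1 - y)"
      using 1 y by (intro mult_left_mono) auto
    also have "\<dots> \<le> (2 * real (Suc k)) * y ^ k * (1 - y)"
      using y by (intro mult_right_mono) (auto simp: 2)
    also have "\<dots> \<le> 2"
      using power_mult_diff_le_one[of y k] y by (simp only: mult.assoc) simp
    finally have "real n * t * y ^ (n - 1) \<le> 2 / \<alpha>"
      using assms(1) by (simp add: field_simps)
    then have "(real n * t * y ^ (n - 1))\<^sup>2 \<le> (2 / \<alpha>)\<^sup>2"
      using y assms(2) by (intro power_mono) auto
    then show ?thesis by (simp add: power_divide add_increasing)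
  qed
  then have "(real n * t * y ^ (n - 1))\<^sup>2 * y\<^sup>2 \<le> (t\<^sup>2 + 4 / \<alpha>\<^sup>2) * y\<^sup>2"
    by (intro mult_right_mono) auto
  moreover have "y ^ n = y ^ (n - 1) * y" using assms(3) by (cases n) auto
  ultimately show ?thesis by (simp add: power_mult_distrib mult_ac)
qed

text \<open>The gap factors as y^m (1 - y) (1 + y), and m y^(m - 1) (1 - y) <= 1 absorbs one factor
  m, leaving m times the gap at most 2 y. Since (m + 2) (m + 1) <= 6 m^2 for m >= 1, the constant is
  6 * 4 = 24.\<close>

lemma resonance_gap_bound:
  fixes y :: real
  assumes "0 \<le> y" "y \<le> 1" "m \<ge> 1"
  shows "real (m + 2) * real (m + 1) * (y ^ m - y ^ (m + 2))\<^sup>2 \<le> 24 * y\<^sup>2"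
proof -
  obtain k where k: "m = Suc k" using assms(3) by (cases m) auto
  have "real m * (y ^ m - y ^ (m + 2)) = real (Suc k) * (y ^ k * (1 - y)) * ((1 + y) * y)"
    by (simp add: k algebra_simps)
  also have "\<dots> \<le> 1 * (2 * y)"
    using power_mult_diff_le_one[OF assms(1,2), of k] assms by (intro mult_mono mult_right_mono) auto
  finally have "real m * (y ^ m - y ^ (m + 2)) \<le> 2 * y" by simp
  moreover have "y ^ (m + 2) \<le> y ^ m" using assms by (intro power_decreasing) auto
  ultimately have "(real m * (y ^ m - y ^ (m + 2)))\<^sup>2 \<le> (2 * y)\<^sup>2"
    by (intro power_mono) auto
  then have "6 * ((real m)\<^sup>2 * (y ^ m - y ^ (m + 2))\<^sup>2) \<le> 24 * y\<^sup>2"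
    by (simp add: power_mult_distrib)
  moreover have "real (m + 2) * real (m + 1) * (y ^ m - y ^ (m + 2))\<^sup>2
      \<le> 6 * (real m)\<^sup>2 * (y ^ m - y ^ (m + 2))\<^sup>2"
  proof (rule mult_right_mono)
    have "real m * 1 \<le> real m * real m" using assms(3) by (intro mult_left_mono) auto
    moreover have "real m \<ge> 1" using assms(3) by simp
    moreover have "real (m + 2) * real (m + 1) = real m * real m + 3 * real m + 2"
      by (simp add: algebra_simps)
    ultimately have "real (m + 2) * real (m + 1) \<le> 6 * (real m * real m)" by linarith
    then show "real (m + 2) * real (m + 1) \<le> 6 * (real m)\<^sup>2"
      by (simp add: power2_eq_square)
  qed simp
  ultimately show ?thesis by simp
qed

text \<open>The equation is only available for t > 0; the initial value is reached through
  continuity at 0, after multiplication by the integrating factor.\<close>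

lemma exponential_ode_unique:
  fixes h :: "real \<Rightarrow> real"
  assumes cont: "continuous_on {0..} h"
    and deriv: "\<And>t. t > 0 \<Longrightarrow> (h has_real_derivative c * h t) (at t)"
    and t: "t \<ge> 0"
  shows "h t = exp (c * t) * h 0"
proof (cases "t = 0")
  case False
  with t have "t > 0" by simp
  define k where "k s = exp (- (c * s)) * h s" for s
  have "continuous_on {0..t} k"
    unfolding k_def by (intro continuous_intros continuous_on_subset[OF cont]) auto
  moreover have "(k has_real_derivative 0) (at s)" if "s > 0" for s
    unfolding k_def by (rule derivative_eq_intros deriv[OF that] refl | simp)+
  ultimately have "k t = k 0"
    using \<open>t > 0\<close> by (intro DERIV_isconst_end) auto
  then have "exp (c * t) * (exp (- (c * t)) * h t) = exp (c * t) * h 0" by (simp add: k_def)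
  then show ?thesis by (simp flip: mult.assoc exp_add)
qed simp

lemma square_sum3_le: "(u - v - w)\<^sup>2 \<le> 3 * u\<^sup>2 + 3 * v\<^sup>2 + 3 * w\<^sup>2" for u v w :: real
proof -
  have "0 \<le> (u + v)\<^sup>2 + (u + w)\<^sup>2 + (v - w)\<^sup>2" by simp
  then show ?thesis by (simp add: power2_eq_square algebra_simps)
qed

context gaussian_weight
begin

text \<open>The coefficient 3 is the price of splitting each V-moment into three summands before
  squaring. The number 30 is 3 * 4 + 3 * 6, with 4 from \<open>linear_growth_decay_bound\<close> and
  6 = 24 / 4 from \<open>resonance_gap_bound\<close> and the square of the 2 in the denominator of
  \<open>R\<close>.\<close>

theorem moment_decay:
  assumes u: "L2_curve u" "C21 u" and v: "L2_curve v" "C21 v"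
    and eq_u: "\<And>x t. t > 0 \<Longrightarrow> d_t u x t = d_x (\<lambda>x t. d_x u x t + \<alpha> * x * u x t) x t"
    and eq_v: "\<And>x t. t > 0 \<Longrightarrow>
      d_t v x t = d_x (\<lambda>x t. d_x v x t + \<alpha> * x * v x t) x t + \<beta> * (x * d_x u x t + u x t)"
    and mass_u: "moment (\<lambda>x. u x 0) 1 = 1" and mass_v: "moment (\<lambda>x. v x 0) 1 = 0"
    and t: "t \<ge> 0"
  defines "U \<equiv> \<lambda>t x. u x t - gauss x"
    and "V \<equiv> \<lambda>t x. v x t - poly (smult (- \<beta> / 2) (hermite 2)) x * gauss x"
  shows "weighted_norm_sq (U t) + weighted_norm_sq (V t) \<le>
    exp (- 2 * \<alpha> * t) * (3 * weighted_norm_sq (V 0) + (1 + 3 * \<beta>\<^sup>2 * t\<^sup>2 + 30 * \<beta>\<^sup>2 / \<alpha>\<^sup>2) * weighted_norm_sq (U 0))"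
proof -
  have gauss: "weighted gauss" "moment gauss (hermite n) = (if n = 0 then 1 else 0)" for n
    using weighted_poly_gauss[of 1] moment_poly_gauss[of 1 "hermite n"] hermite_orthogonal[of 0 n] by simp_all
  have ginf: "weighted (\<lambda>x. poly (smult (- \<beta> / 2) (hermite 2)) x * gauss x)"
    "moment (\<lambda>x. poly (smult (- \<beta> / 2) (hermite 2)) x * gauss x) (hermite n) = (if n = 2 then - \<beta> / \<alpha>\<^sup>2 else 0)" for n
    unfolding moment_poly_gauss mult_smult_left gauss_integral_smult hermite_orthogonal
    by (rule weighted_poly_gauss) simp
  have wU: "weighted (U s)" and wV: "weighted (V s)" if "s \<ge> 0" for s
    unfolding U_def V_def
    by (intro weighted_diff gauss(1) ginf(1) L2_curve_weighted[OF u(1)] L2_curve_weighted[OF v(1)] that)+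
  have pU: "moment (U s) (hermite n) = moment (\<lambda>x. u x s) (hermite n) - (if n = 0 then 1 else 0)"
    and pV: "moment (V s) (hermite n) = moment (\<lambda>x. v x s) (hermite n) - (if n = 2 then - \<beta> / \<alpha>\<^sup>2 else 0)"
    if "s \<ge> 0" for s n
    unfolding U_def V_def gauss(2)[symmetric] ginf(2)[symmetric]
    by (intro moment_diff gauss ginf L2_curve_weighted u v that)+
  define F G where "F n = moment (U 0) (hermite n)" and "G n = moment (V 0) (hermite n)" for n
  have F0: "F 0 = 0" and G0: "G 0 = 0"
    using pU[of 0 0] pV[of 0 0] mass_u mass_v by (simp_all add: F_def G_def)
  have momentU: "moment (U s) (hermite n) = exp (- (\<alpha> * real n) * s) * F n" if "s \<ge> 0" for s n
  proof -
    define h where "h s = moment (\<lambda>x. u x s) (hermite n) - (if n = 0 then 1 else 0)" for s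
    have "h s = exp (- (\<alpha> * real n) * s) * h 0"
    proof (rule exponential_ode_unique[OF _ _ that])
      show "continuous_on {0..} h"
        unfolding h_def by (intro continuous_intros moment_continuous u)
      fix r :: real assume r: "r > 0"
      have "((\<lambda>s. moment (\<lambda>x. u x s) (hermite n)) has_real_derivative
          moment (\<lambda>x. u x r) (generator (hermite n)) - 0 * moment (\<lambda>x. u x r) ([:0, 1:] * pderiv (hermite n))) (at r)"
        by (rule moment_has_derivative[OF u u r]) (simp add: eq_u)
      then have "((\<lambda>s. moment (\<lambda>x. u x s) (hermite n)) has_real_derivative
          - (\<alpha> * real n) * moment (\<lambda>x. u x r) (hermite n)) (at r)"
        unfolding generator_hermite moment_smult by simp
      from DERIV_diff[OF this DERIV_const]
      have "(h has_real_derivative - (\<alpha> * real n) * moment (\<lambda>x. u x r) (hermite n) - 0) (at r)"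
        unfolding h_def .
      then show "(h has_real_derivative - (\<alpha> * real n) * h r) (at r)"
        by (cases "n = 0") (simp_all add: h_def)
    qed
    then show ?thesis using pU[OF that] pU[of 0] by (simp add: h_def F_def)
  qed
  define y where "y = exp (- \<alpha> * t)"
  have y: "0 < y" "y \<le> 1" using t \<alpha>_pos by (auto simp: y_def)
  have y_pow: "exp (- (\<alpha> * real n) * t) = y ^ n" for n
    by (simp add: y_def mult_ac flip: exp_of_nat_mult)
  \<comment> \<open>Variation of constants for the coupling to degree n - 2: the two decay rates
    differ by 2 \<alpha>, so the convolution of the exponentials is their difference divided by 2
    \<alpha>.\<close>
  define R where "R n s = \<beta> * real n * real (n - 1) / (2 * \<alpha>\<^sup>2) * F (n - 2) *
      (exp (- (\<alpha> * real (n - 2)) * s) - exp (- (\<alpha> * real n) * s))" for n s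
  have momentV: "moment (V s) (hermite n)
      = exp (- (\<alpha> * real n) * s) * G n - \<beta> * real n * s * exp (- (\<alpha> * real n) * s) * F n - R n s" if "s \<ge> 0" for s n
  proof -
    \<comment> \<open>Adding both particular terms back to the deviation leaves a solution of the
      homogeneous equation. Both terms vanish at time 0, so its initial value is
      \<open>G n\<close>.\<close>
    define h where "h s = moment (\<lambda>x. v x s) (hermite n) - (if n = 2 then - \<beta> / \<alpha>\<^sup>2 else 0)
       + \<beta> * real n * s * exp (- (\<alpha> * real n) * s) * F n + R n s" for s
    have "h s = exp (- (\<alpha> * real n) * s) * h 0"
    proof (rule exponential_ode_unique[OF _ _ that])
      show "continuous_on {0..} h"
        unfolding h_def R_def by (intro continuous_intros moment_continuous v)
      fix r :: real assume r: "r > 0"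
      define A where "A = moment (\<lambda>x. v x r) (hermite n)"
      define e where "e = exp (- (\<alpha> * real n) * r)"
      define e2 where "e2 = exp (- (\<alpha> * real (n - 2)) * r)"
      \<comment> \<open>The undeviated moment of order 0 contributes the constant 1. For n = 2 this
        is a constant forcing, balanced exactly by the steady value - \<beta> / \<alpha>^2.\<close>
      have up: "moment (\<lambda>x. u x r) (hermite k) = exp (- (\<alpha> * real k) * r) * F k + (if k = 0 then 1 else 0)" for k
        using pU[of r k] momentU[of r k] r by simp
      have dA: "((\<lambda>s. moment (\<lambda>x. v x s) (hermite n)) has_real_derivative
          moment (\<lambda>x. v x r) (generator (hermite n)) - \<beta> * moment (\<lambda>x. u x r) ([:0, 1:] * pderiv (hermite n))) (at r)"
        by (rule moment_has_derivative[OF v u r]) (simp add: eq_v)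
      also have "moment (\<lambda>x. v x r) (generator (hermite n)) - \<beta> * moment (\<lambda>x. u x r) ([:0, 1:] * pderiv (hermite n))
        = - (\<alpha> * real n) * A - \<beta> * (real n * (e * F n)
            + real n * real (n - 1) / \<alpha> * (e2 * F (n - 2) + (if n = 2 then 1 else 0)))"
        unfolding generator_hermite moment_smult up A_def e_def e2_def
          moment_x_pderiv_hermite[OF L2_curve_weighted[OF u(1) less_imp_le[OF r]]]
        by (cases "n \<le> 1") (auto simp: le_Suc_eq)
      finally have dA': "((\<lambda>s. moment (\<lambda>x. v x s) (hermite n)) has_real_derivative
          - (\<alpha> * real n) * A - \<beta> * (real n * (e * F n)
            + real n * real (n - 1) / \<alpha> * (e2 * F (n - 2) + (if n = 2 then 1 else 0)))) (at r)" .
      have dR: "(R n has_real_derivative \<beta> * real n * real (n - 1) / (2 * \<alpha>\<^sup>2) * F (n - 2) *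
          (- (\<alpha> * real (n - 2)) * e2 + \<alpha> * real n * e)) (at r)"
        unfolding R_def e_def e2_def by (rule derivative_eq_intros refl | simp)+
      have dE: "((\<lambda>s. \<beta> * real n * s * exp (- (\<alpha> * real n) * s) * F n) has_real_derivative
          \<beta> * real n * (e - \<alpha> * real n * r * e) * F n) (at r)"
        unfolding e_def by (rule derivative_eq_intros refl | simp add: algebra_simps)+
      have "(h has_real_derivative - (\<alpha> * real n) * A - \<beta> * (real n * (e * F n)
            + real n * real (n - 1) / \<alpha> * (e2 * F (n - 2) + (if n = 2 then 1 else 0))) - 0
          + \<beta> * real n * (e - \<alpha> * real n * r * e) * F n
          + \<beta> * real n * real (n - 1) / (2 * \<alpha>\<^sup>2) * F (n - 2) *
          (- (\<alpha> * real (n - 2)) * e2 + \<alpha> * real n * e)) (at r)"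
        unfolding h_def by (intro DERIV_add DERIV_diff dA' dR dE DERIV_const)
      also have "- (\<alpha> * real n) * A - \<beta> * (real n * (e * F n)
            + real n * real (n - 1) / \<alpha> * (e2 * F (n - 2) + (if n = 2 then 1 else 0))) - 0
          + \<beta> * real n * (e - \<alpha> * real n * r * e) * F n
          + \<beta> * real n * real (n - 1) / (2 * \<alpha>\<^sup>2) * F (n - 2) *
          (- (\<alpha> * real (n - 2)) * e2 + \<alpha> * real n * e)
        = - (\<alpha> * real n) * (A - (if n = 2 then - \<beta> / \<alpha>\<^sup>2 else 0) + \<beta> * real n * r * e * F n
          + \<beta> * real n * real (n - 1) / (2 * \<alpha>\<^sup>2) * F (n - 2) * (e2 - e))"
      proof -
        consider "n = 0" | "n = 1" | k where "n = Suc (Suc k)"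
          by (metis One_nat_def not0_implies_Suc)
        then show ?thesis
        proof cases
          case (3 k)
          have "real (n - 2) = real n - 2" "n = 2 \<longleftrightarrow> k = 0" using 3 by auto
          then show ?thesis
            using \<alpha>_pos by (auto simp: 3 field_simps power2_eq_square)
        qed (simp_all add: algebra_simps)
      qed
      also have "\<dots> = - (\<alpha> * real n) * h r"
        by (simp add: h_def R_def A_def e_def e2_def)
      finally show "(h has_real_derivative - (\<alpha> * real n) * h r) (at r)" .
    qed
    moreover have "h 0 = G n" using pV[of 0 n] by (simp add: h_def R_def G_def)
    ultimately show ?thesis using pV[OF that, of n] by (simp add: h_def)
  qed
  define w where "w n = \<alpha> ^ n / fact n" for n
  have w: "w n > 0" for n using \<alpha>_pos by (simp add: w_def)
  \<comment> \<open>The coupling compares degree n with the initial coefficient of degree n - 2.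
    Padding with two zeros aligns the indices without changing the sum.\<close>
  define S where "S n = (if n < 2 then 0 else (F (n - 2))\<^sup>2 * w (n - 2))" for n
  have sU0: "(\<lambda>n. (F n)\<^sup>2 * w n) sums weighted_norm_sq (U 0)"
    unfolding F_def w_def by (rule hermite_Parseval) (simp add: wU)
  have sV0: "(\<lambda>n. (G n)\<^sup>2 * w n) sums weighted_norm_sq (V 0)"
    unfolding G_def w_def by (rule hermite_Parseval) (simp add: wV)
  have sU: "(\<lambda>n. (moment (U t) (hermite n))\<^sup>2 * w n) sums weighted_norm_sq (U t)"
    unfolding w_def by (rule hermite_Parseval) (simp add: wU t)
  have sV: "(\<lambda>n. (moment (V t) (hermite n))\<^sup>2 * w n) sums weighted_norm_sq (V t)"
    unfolding w_def by (rule hermite_Parseval) (simp add: wV t)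
  have sS: "S sums weighted_norm_sq (U 0)"
    using sU0 by (subst sums_iff_shift'[of _ 2, symmetric]) (auto simp: S_def numeral_2_eq_2)
  have "weighted_norm_sq (U t) \<le> y\<^sup>2 * weighted_norm_sq (U 0)"
  proof (rule sums_le[OF _ sU sums_mult[OF sU0]])
    fix n
    show "(moment (U t) (hermite n))\<^sup>2 * w n \<le> y\<^sup>2 * ((F n)\<^sup>2 * w n)"
    proof (cases "n = 0")
      case False
      then have "y ^ n \<le> y ^ 1" using y by (intro power_decreasing) auto
      then have "(y ^ n)\<^sup>2 \<le> y\<^sup>2" using y by (intro power_mono) auto
      then have "(y ^ n)\<^sup>2 * ((F n)\<^sup>2 * w n) \<le> y\<^sup>2 * ((F n)\<^sup>2 * w n)"
        using less_imp_le[OF w] by (intro mult_right_mono) auto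
      then show ?thesis unfolding momentU[OF t] y_pow by (simp add: power_mult_distrib mult.assoc)
    qed (use momentU[OF t, of 0] F0 in simp)
  qed
  moreover have "weighted_norm_sq (V t) \<le> y\<^sup>2 * (3 * weighted_norm_sq (V 0) + 3 * \<beta>\<^sup>2 * (t\<^sup>2 + 4 / \<alpha>\<^sup>2) * weighted_norm_sq (U 0) + 18 * \<beta>\<^sup>2 / \<alpha>\<^sup>2 * weighted_norm_sq (U 0))"
  proof (rule sums_le[OF _ sV sums_mult[OF sums_add[OF sums_add[OF sums_mult[OF sV0] sums_mult[OF sU0]] sums_mult[OF sS]]]])
    fix n
    show "(moment (V t) (hermite n))\<^sup>2 * w n \<le>
      y\<^sup>2 * (3 * ((G n)\<^sup>2 * w n) + 3 * \<beta>\<^sup>2 * (t\<^sup>2 + 4 / \<alpha>\<^sup>2) * ((F n)\<^sup>2 * w n) + 18 * \<beta>\<^sup>2 / \<alpha>\<^sup>2 * S n)"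
    proof (cases "n = 0")
      case True
      then show ?thesis
        using momentV[OF t, of 0] by (simp add: F0 G0 R_def S_def)
    next
      case False
      then have n: "n \<ge> 1" by simp
      have 1: "(y ^ n * G n)\<^sup>2 * w n \<le> y\<^sup>2 * ((G n)\<^sup>2 * w n)"
      proof -
        have "y ^ n \<le> y ^ 1" using y n by (intro power_decreasing) auto
        then have "(y ^ n)\<^sup>2 \<le> y\<^sup>2" using y by (intro power_mono) auto
        then have "(y ^ n)\<^sup>2 * ((G n)\<^sup>2 * w n) \<le> y\<^sup>2 * ((G n)\<^sup>2 * w n)"
          using less_imp_le[OF w] by (intro mult_right_mono) auto
        then show ?thesis by (simp add: power_mult_distrib mult.assoc)
      qed
      have 2: "(\<beta> * real n * t * y ^ n * F n)\<^sup>2 * w n \<le> y\<^sup>2 * (\<beta>\<^sup>2 * (t\<^sup>2 + 4 / \<alpha>\<^sup>2) * ((F n)\<^sup>2 * w n))"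
      proof -
        have "(real n * t * y ^ n)\<^sup>2 * (\<beta>\<^sup>2 * (F n)\<^sup>2 * w n) \<le> (t\<^sup>2 + 4 / \<alpha>\<^sup>2) * y\<^sup>2 * (\<beta>\<^sup>2 * (F n)\<^sup>2 * w n)"
          using linear_growth_decay_bound[OF \<alpha>_pos t n] less_imp_le[OF w]
          unfolding y_def by (intro mult_right_mono) auto
        then show ?thesis by (simp add: power_mult_distrib mult_ac)
      qed
      have 3: "(R n t)\<^sup>2 * w n \<le> y\<^sup>2 * (6 * \<beta>\<^sup>2 / \<alpha>\<^sup>2 * S n)"
      proof (cases "n < 3")
        case True
        \<comment> \<open>For n = 1 the factor n - 1 vanishes; for n = 2 the coefficient is
          \<open>F 0\<close>, which is zero by conservation of the unit mass. Thus m >= 1 in the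
          other case.\<close>
        then have "R n t = 0" using F0 n by (auto simp: R_def numeral_eq_Suc less_Suc_eq)
        then show ?thesis using less_imp_le[OF w] by (simp add: S_def)
      next
        case False
        define m where "m = n - 2"
        have m: "n = m + 2" "m \<ge> 1" using False by (auto simp: m_def)
        \<comment> \<open>This weight ratio cancels one of the two factors n (n - 1) in the square
          of \<open>R n t\<close>; the other one is left for
          \<open>resonance_gap_bound\<close>.\<close>
        have "w n = \<alpha>\<^sup>2 * w m / (real (m + 2) * real (m + 1))"
          by (simp add: w_def m power2_eq_square algebra_simps)
        moreover have "R n t = \<beta> * real (m + 2) * real (m + 1) / (2 * \<alpha>\<^sup>2) * F m * (y ^ m - y ^ (m + 2))"
          unfolding R_def y_pow by (simp add: m)
        moreover have rescale: "(\<beta> * p * q / (2 * \<alpha>\<^sup>2) * f * d)\<^sup>2 * (\<alpha>\<^sup>2 * c / (p * q))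
            = \<beta>\<^sup>2 / (4 * \<alpha>\<^sup>2) * (f\<^sup>2 * c) * (p * q * d\<^sup>2)" if "p > 0" "q > 0" for p q f d c :: real
          using \<alpha>_pos that by (simp add: field_simps power2_eq_square)
        ultimately have "(R n t)\<^sup>2 * w n = \<beta>\<^sup>2 / (4 * \<alpha>\<^sup>2) * ((F m)\<^sup>2 * w m)
            * (real (m + 2) * real (m + 1) * (y ^ m - y ^ (m + 2))\<^sup>2)"
          using rescale[of "real (m + 2)" "real (m + 1)"] by simp
        also have "\<dots> \<le> \<beta>\<^sup>2 / (4 * \<alpha>\<^sup>2) * ((F m)\<^sup>2 * w m) * (24 * y\<^sup>2)"
          using resonance_gap_bound[of y m] y m(2) less_imp_le[OF w]
          by (intro mult_left_mono) auto
        also have "\<dots> = y\<^sup>2 * (6 * \<beta>\<^sup>2 / \<alpha>\<^sup>2 * S n)"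
          using \<alpha>_pos by (simp add: S_def m)
        finally show ?thesis .
      qed
      have "(moment (V t) (hermite n))\<^sup>2 * w n
          = (y ^ n * G n - \<beta> * real n * t * y ^ n * F n - R n t)\<^sup>2 * w n"
        by (simp only: momentV[OF t] y_pow)
      also have "\<dots> \<le> (3 * (y ^ n * G n)\<^sup>2 + 3 * (\<beta> * real n * t * y ^ n * F n)\<^sup>2 + 3 * (R n t)\<^sup>2) * w n"
        by (intro mult_right_mono square_sum3_le less_imp_le[OF w])
      also have "\<dots> = 3 * ((y ^ n * G n)\<^sup>2 * w n) + 3 * ((\<beta> * real n * t * y ^ n * F n)\<^sup>2 * w n) + 3 * ((R n t)\<^sup>2 * w n)"
        by (simp only: ring_distribs mult.assoc)
      also have "\<dots> \<le> 3 * (y\<^sup>2 * ((G n)\<^sup>2 * w n)) + 3 * (y\<^sup>2 * (\<beta>\<^sup>2 * (t\<^sup>2 + 4 / \<alpha>\<^sup>2) * ((F n)\<^sup>2 * w n)))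
          + 3 * (y\<^sup>2 * (6 * \<beta>\<^sup>2 / \<alpha>\<^sup>2 * S n))"
        using 1 2 3 by (intro add_mono mult_left_mono) auto
      finally show ?thesis by (simp add: algebra_simps)
    qed
  qed
  ultimately have "weighted_norm_sq (U t) + weighted_norm_sq (V t) \<le> y\<^sup>2 * (3 * weighted_norm_sq (V 0) + (1 + 3 * \<beta>\<^sup>2 * t\<^sup>2 + 30 * \<beta>\<^sup>2 / \<alpha>\<^sup>2) * weighted_norm_sq (U 0))"
    by (simp add: algebra_simps add_divide_distrib)
  moreover have "y\<^sup>2 = exp (- 2 * \<alpha> * t)"
    by (simp add: y_def flip: exp_double)
  ultimately show ?thesis by simp
qed

end

section \<open>Uniformity in the parameter\<close>

lemma f_inf_eq_gauss: "0 < a z \<Longrightarrow> f_inf a x z = gaussian_weight.gauss (a z) x"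
  by (simp add: f_inf_def gaussian_weight.gauss_def gaussian_weight_def)

text \<open>Differentiating the normalising root gives \<beta> / (2 a) and the exponent gives -
  \<beta> x^2 / 2; together they form - \<beta> / 2 times the second Hermite polynomial x^2 - 1 / a,
  so the second steady state is a single mode.\<close>

lemma g_inf_eq:
  assumes "0 < a z" "(a has_real_derivative \<beta>) (at z)"
  shows "g_inf a x z = poly (smult (- \<beta> / 2) (gaussian_weight.hermite (a z) 2)) x * gaussian_weight.gauss (a z) x"
proof -
  interpret gaussian_weight "a z" by standard (rule assms(1))
  have "((\<lambda>\<zeta>. f_inf a x \<zeta>) has_real_derivative \<beta> * (1 / (2 * a z) - x\<^sup>2 / 2) * gauss x) (at z)"
  proof -
    have "((\<lambda>\<zeta>. sqrt (a \<zeta> / (2 * pi))) has_real_derivative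
        inverse (sqrt (a z / (2 * pi))) / 2 * (\<beta> / (2 * pi))) (at z)"
      by (rule DERIV_chain2[OF DERIV_real_sqrt DERIV_cdivide[OF assms(2)]]) (use assms(1) in simp)
    also have "inverse (sqrt (a z / (2 * pi))) / 2 * (\<beta> / (2 * pi)) = \<beta> / (2 * a z) * sqrt (a z / (2 * pi))"
    proof -
      define s where "s = sqrt (a z / (2 * pi))"
      have "s > 0" "s * s = a z / (2 * pi)" using assms(1) by (auto simp: s_def)
      then show ?thesis
        using assms(1) unfolding s_def[symmetric] by (simp add: field_simps)
    qed
    finally have 1: "((\<lambda>\<zeta>. sqrt (a \<zeta> / (2 * pi))) has_real_derivative \<beta> / (2 * a z) * sqrt (a z / (2 * pi))) (at z)" .
    have 2: "((\<lambda>\<zeta>. exp (- (x\<^sup>2 / 2) * a \<zeta>)) has_real_derivative exp (- (x\<^sup>2 / 2) * a z) * (- (x\<^sup>2 / 2) * \<beta>)) (at z)"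
      by (rule DERIV_chain2[OF DERIV_exp DERIV_cmult[OF assms(2)]])
    show ?thesis
      unfolding f_inf_def gauss_def by (rule DERIV_cong[OF DERIV_mult[OF 1 2]]) (simp add: algebra_simps)
  qed
  then have g: "g_inf a x z = \<beta> * (1 / (2 * a z) - x\<^sup>2 / 2) * gauss x"
    unfolding g_inf_def by (rule DERIV_imp_deriv)
  have h: "poly (hermite 2) x = x\<^sup>2 - 1 / a z"
    by (simp add: numeral_2_eq_2 pderiv_pCons power2_eq_square)
  show ?thesis unfolding g poly_smult h by (simp add: algebra_simps)
qed

lemma wnorm_sq_eq:
  assumes "0 < a z"
  shows "wnorm_sq a z \<phi> = (\<integral>\<^sup>+x. ennreal ((gaussian_weight.normed (a z) \<phi> x)\<^sup>2) \<partial>lebesgue)"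
proof -
  interpret gaussian_weight "a z" by standard (rule assms)
  show ?thesis by (simp add: wnorm_sq_def normed_square f_inf_eq_gauss assms)
qed

lemma weighted_L2_iff:
  assumes "0 < a z"
  shows "\<phi> \<in> weighted_L2 a z \<longleftrightarrow> gaussian_weight.weighted (a z) \<phi>"
proof -
  interpret gaussian_weight "a z" by standard (rule assms)
  have "weighted \<phi> \<longleftrightarrow> \<phi> \<in> borel_measurable lebesgue \<and> integrable lebesgue (\<lambda>x. (normed \<phi> x)\<^sup>2)"
    by (simp add: weighted_def sq_integrable_def normed_measurable)
  also have "\<dots> \<longleftrightarrow> \<phi> \<in> borel_measurable lebesgue \<and> wnorm_sq a z \<phi> < \<infinity>"
    unfolding wnorm_sq_eq[of a z, OF assms]
    using borel_measurable_power[of "normed \<phi>" lebesgue 2]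
    by (auto simp: integrable_iff_bounded normed_measurable)
  finally show ?thesis by (simp add: weighted_L2_def)
qed

lemma wnorm_sq_eq_weighted_norm_sq:
  assumes "0 < a z" "gaussian_weight.weighted (a z) \<phi>"
  shows "wnorm_sq a z \<phi> = ennreal (gaussian_weight.weighted_norm_sq (a z) \<phi>)"
proof -
  interpret gaussian_weight "a z" by standard (rule assms)
  show ?thesis
    unfolding wnorm_sq_eq[of a z, OF assms(1)] weighted_norm_sq_def
    using assms(2) by (intro nn_integral_eq_integral) (auto simp: weighted_def sq_integrable_def)
qed

lemma L2_continuous_imp_L2_curve:
  assumes "0 < a z" "L2_continuous a z u"
  shows "gaussian_weight.L2_curve (a z) u"
proof -
  interpret gaussian_weight "a z" by standard (rule assms)
  have wt: "weighted (\<lambda>x. u x t)" if "t \<ge> 0" for t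
    using assms that by (simp add: L2_continuous_def weighted_L2_iff)
  have "((\<lambda>s. weighted_norm_sq (\<lambda>x. u x s - u x t)) \<longlongrightarrow> 0) (at t within {0..})" if t: "t \<ge> 0" for t
  proof (rule tendsto_ennrealD)
    have "((\<lambda>s. wnorm_sq a z (\<lambda>x. u x s - u x t)) \<longlongrightarrow> ennreal 0) (at t within {0..})"
      using assms(2) t by (simp add: L2_continuous_def)
    moreover have "\<forall>\<^sub>F s in at t within {0..}.
        wnorm_sq a z (\<lambda>x. u x s - u x t) = ennreal (weighted_norm_sq (\<lambda>x. u x s - u x t))"
      unfolding eventually_at_filter
      by (intro always_eventually allI impI wnorm_sq_eq_weighted_norm_sq assms(1) weighted_diff wt) (use t in auto)
    ultimately show "((\<lambda>s. ennreal (weighted_norm_sq (\<lambda>x. u x s - u x t))) \<longlongrightarrow> ennreal 0) (at t within {0..})"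
      by (rule Lim_transform_eventually)
  qed (simp_all add: weighted_norm_sq_nonneg)
  then show ?thesis by (simp add: L2_curve_def wt)
qed

text \<open>For continuous v the set where the essential bound is exceeded is open, and an open null
  set is empty. This yields a bound at every z rather than almost every z.\<close>

lemma abs_le_Linf_norm:
  fixes v :: "real \<Rightarrow> real"
  assumes "continuous_on UNIV v" "Linf_norm v < \<infinity>"
  shows "\<bar>v z\<bar> \<le> real_of_ereal (Linf_norm v)"
proof -
  define M where "M = Linf_norm v"
  have ae: "AE z in lebesgue. ereal \<bar>v z\<bar> \<le> M"
    unfolding M_def Linf_norm_def by (rule esssup_AE)
  have "M \<noteq> -\<infinity>"
  proof
    assume "M = -\<infinity>"
    with ae have "AE z in (lebesgue :: real measure). False" by simp
    then have "emeasure lebesgue (UNIV :: real set) = 0"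
      using AE_iff_measurable[of UNIV "lebesgue :: real measure" "\<lambda>_. False"] by simp
    then show False by simp
  qed
  then obtain m where m: "M = ereal m"
    using assms(2) by (cases M) (auto simp: M_def)
  define S where "S = {z. m < \<bar>v z\<bar>}"
  have "open S"
    unfolding S_def using assms(1) by (intro open_Collect_less continuous_intros)
  moreover have "AE z in lebesgue. z \<notin> S"
    using ae by eventually_elim (simp add: S_def m)
  ultimately have "S \<in> null_sets lebesgue"
    using AE_iff_null_sets[of S "lebesgue"] by (simp add: lborelD borel_open)
  then have "negligible S" by (simp add: negligible_iff_null_sets)
  with \<open>open S\<close> have "S = {}" using open_not_negligible by blast
  then show ?thesis by (auto simp: S_def m not_less simp flip: M_def)
qed

text \<open>Keeping only the product of 12, \<open>max 2 (1 + \<mu>)\<close> and 7 leaves 2 * 12 * 7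
  = 168 times K (1 + \<mu>). The quotients \<beta>^2 / \<alpha>^2 are at most \<mu>; for the
  coefficient of t^2, which involves \<beta>^2 alone, the factor \<open>max 1 (a0\<^sup>2)\<close>
  is decisive, as M^2 = a0^2 \<mu> <= K (1 + \<mu>).\<close>

lemma decay_const_bound:
  assumes "0 < a0" "a0 \<le> \<alpha>" "\<bar>\<beta>\<bar> \<le> M" "t \<ge> 0"
  shows "3 \<le> decay_const a0 M * (1 + t\<^sup>2)"
    and "1 + 3 * \<beta>\<^sup>2 * t\<^sup>2 + 30 * \<beta>\<^sup>2 / \<alpha>\<^sup>2 \<le> decay_const a0 M * (1 + t\<^sup>2)"
proof -
  define \<mu> where "\<mu> = M\<^sup>2 / a0\<^sup>2"
  have \<mu>: "\<mu> \<ge> 0" by (simp add: \<mu>_def)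
  define K where "K = max 1 (a0\<^sup>2)"
  have K: "K \<ge> 1" "K \<ge> a0\<^sup>2" by (auto simp: K_def)
  have "7 * (1 + \<mu>) \<le> max 2 (1 + \<mu>) * (7 + 21 / 4 * (M ^ 4 / a0 ^ 4))"
  proof -
    have "(1 + \<mu>) * 7 \<le> max 2 (1 + \<mu>) * (7 + 21 / 4 * (M ^ 4 / a0 ^ 4))"
      using \<mu> by (intro mult_mono) auto
    then show ?thesis by simp
  qed
  then have "2 * K * (84 * (1 + \<mu>)) \<le> decay_const a0 M"
    unfolding decay_const_def K_def[symmetric] \<mu>_def[symmetric]
    using K by (intro mult_left_mono) (auto intro: add_increasing2)
  then have C: "168 * (K * (1 + \<mu>)) \<le> decay_const a0 M" by (simp add: algebra_simps)
  have "1 * (1 + \<mu>) \<le> K * (1 + \<mu>)" "a0\<^sup>2 * (1 + \<mu>) \<le> K * (1 + \<mu>)"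
    using K \<mu> by (intro mult_right_mono; simp)+
  moreover have "a0\<^sup>2 * \<mu> = M\<^sup>2" using assms(1) by (simp add: \<mu>_def)
  ultimately have C1: "1 + \<mu> \<le> K * (1 + \<mu>)" and C2: "M\<^sup>2 \<le> K * (1 + \<mu>)"
    by (auto simp: distrib_left intro: order_trans[rotated])
  have "\<beta>\<^sup>2 \<le> M\<^sup>2" using assms(3) by (metis abs_ge_zero power2_abs power_mono)
  then have "\<beta>\<^sup>2 / \<alpha>\<^sup>2 \<le> \<mu>"
    unfolding \<mu>_def using assms(1,2) by (intro frac_le) (auto intro: power_mono)
  then have "1 + 30 * (\<beta>\<^sup>2 / \<alpha>\<^sup>2) \<le> decay_const a0 M" and 3: "3 \<le> decay_const a0 M"
    using C C1 \<mu> by linarith+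
  moreover have "3 * \<beta>\<^sup>2 * t\<^sup>2 \<le> decay_const a0 M * t\<^sup>2"
  proof (rule mult_right_mono)
    show "3 * \<beta>\<^sup>2 \<le> decay_const a0 M"
      using \<open>\<beta>\<^sup>2 \<le> M\<^sup>2\<close> C C1 C2 \<mu> by linarith
  qed simp
  ultimately show "1 + 3 * \<beta>\<^sup>2 * t\<^sup>2 + 30 * \<beta>\<^sup>2 / \<alpha>\<^sup>2 \<le> decay_const a0 M * (1 + t\<^sup>2)"
    by (simp add: distrib_left)
  have "0 \<le> decay_const a0 M * t\<^sup>2"
    by (rule mult_nonneg_nonneg) (use 3 in simp_all)
  with 3 show "3 \<le> decay_const a0 M * (1 + t\<^sup>2)"
    unfolding distrib_left by linarith
qed

text \<open>Here the dependence on z disappears: a z >= a0 enlarges the exponential, and both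
  coefficients, which involve a z and \<beta>, are replaced by one that involves only a0 and
  M.\<close>

lemma solution_decay:
  assumes az: "0 < a0" "a0 \<le> a z" and deriv: "(a has_real_derivative \<beta>) (at z)" and M: "\<bar>\<beta>\<bar> \<le> M"
    and sol: "solves_system a f g" and norm: "normalized a (\<lambda>x z. f x z 0) (\<lambda>x z. g x z 0)"
    and t: "t \<ge> 0"
  shows "pair_norm_sq a z (\<lambda>x. f x z t - f_inf a x z) (\<lambda>x. g x z t - g_inf a x z)
    \<le> ennreal (decay_const a0 M * (1 + t\<^sup>2) * exp (- 2 * a0 * t)) *
      pair_norm_sq a z (\<lambda>x. f x z 0 - f_inf a x z) (\<lambda>x. g x z 0 - g_inf a x z)"
proof -
  have pos: "0 < a z" using az by simp
  interpret gaussian_weight "a z" by standard (rule pos)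
  define u v where "u x t = f x z t" and "v x t = g x z t" for x t
  define U V where "U t x = u x t - gauss x"
    and "V t x = v x t - poly (smult (- \<beta> / 2) (hermite 2)) x * gauss x" for t x
  have u: "L2_curve u" "C21 u" and v: "L2_curve v" "C21 v"
    using sol unfolding solves_system_def u_def v_def
    by (auto intro: L2_continuous_imp_L2_curve pos)
  have \<beta>: "deriv a z = \<beta>" using deriv by (rule DERIV_imp_deriv)
  have eq_u: "d_t u x t = d_x (\<lambda>x t. d_x u x t + a z * x * u x t) x t"
    and eq_v: "d_t v x t = d_x (\<lambda>x t. d_x v x t + a z * x * v x t) x t + \<beta> * (x * d_x u x t + u x t)"
    if "t > 0" for x t
    using sol that unfolding solves_system_def u_def v_def \<beta>[symmetric] by blast+
  have mass: "moment (\<lambda>x. u x 0) 1 = 1" "moment (\<lambda>x. v x 0) 1 = 0"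
    using norm by (simp_all add: normalized_def moment_def u_def v_def)
  have wt: "weighted (U s)" "weighted (V s)" if "s \<ge> 0" for s
    unfolding U_def V_def using weighted_poly_gauss[of 1]
    by (intro weighted_diff weighted_poly_gauss L2_curve_weighted[OF u(1) that] L2_curve_weighted[OF v(1) that]; simp)+
  have pn: "pair_norm_sq a z (\<lambda>x. f x z s - f_inf a x z) (\<lambda>x. g x z s - g_inf a x z)
      = ennreal (weighted_norm_sq (U s) + weighted_norm_sq (V s))" if "s \<ge> 0" for s
  proof -
    have "(\<lambda>x. f x z s - f_inf a x z) = U s" "(\<lambda>x. g x z s - g_inf a x z) = V s"
      by (simp_all add: fun_eq_iff U_def V_def u_def v_def f_inf_eq_gauss[of a z, OF pos] g_inf_eq[OF pos deriv])
    then show ?thesis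
      using wnorm_sq_eq_weighted_norm_sq[of a z, OF pos] wt[OF that]
      by (simp add: pair_norm_sq_def weighted_norm_sq_nonneg)
  qed
  define D where "D = decay_const a0 M * (1 + t\<^sup>2)"
  note D = decay_const_bound[OF az M t, folded D_def]
  have "weighted_norm_sq (U t) + weighted_norm_sq (V t) \<le> exp (- 2 * a z * t) *
      (3 * weighted_norm_sq (V 0) + (1 + 3 * \<beta>\<^sup>2 * t\<^sup>2 + 30 * \<beta>\<^sup>2 / (a z)\<^sup>2) * weighted_norm_sq (U 0))"
    unfolding U_def V_def by (rule moment_decay[OF u v eq_u eq_v mass t])
  also have "\<dots> \<le> exp (- 2 * a0 * t) * (D * weighted_norm_sq (V 0) + D * weighted_norm_sq (U 0))"
    using az t D weighted_norm_sq_nonneg by (intro mult_mono add_mono mult_right_mono) (auto intro: mult_right_mono)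
  also have "\<dots> = D * exp (- 2 * a0 * t) * (weighted_norm_sq (U 0) + weighted_norm_sq (V 0))"
    by (simp add: algebra_simps)
  finally have "ennreal (weighted_norm_sq (U t) + weighted_norm_sq (V t)) \<le> ennreal (D * exp (- 2 * a0 * t) * (weighted_norm_sq (U 0) + weighted_norm_sq (V 0)))"
    by (rule ennreal_leI)
  also have "\<dots> = ennreal (D * exp (- 2 * a0 * t)) * ennreal (weighted_norm_sq (U 0) + weighted_norm_sq (V 0))"
    using D(1) weighted_norm_sq_nonneg by (intro ennreal_mult) auto
  finally show ?thesis
    using t by (simp add: pn D_def)
qed

theorem theorem5p2:
  fixes a :: "real \<Rightarrow> real" and a0 :: real
  assumes "a C1_differentiable_on UNIV"
    and "bdd_below (range a)"
    and "a0 = (INF z. a z)"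
    and "a0 > 0"
    and "Linf_norm (deriv a) < \<infinity>"
  shows "\<exists>C>0. C = decay_const a0 (real_of_ereal (Linf_norm (deriv a))) \<and>
    (\<forall>f g :: real \<Rightarrow> real \<Rightarrow> real \<Rightarrow> real.
       solves_system a f g \<and> normalized a (\<lambda>x z. f x z 0) (\<lambda>x z. g x z 0) \<longrightarrow>
       (\<forall>t\<ge>0.
          (SUP z. pair_norm_sq a z (\<lambda>x. f x z t - f_inf a x z) (\<lambda>x. g x z t - g_inf a x z))
          \<le> ennreal (C * (1 + t\<^sup>2) * exp (- 2 * a0 * t)) *
            (SUP z. pair_norm_sq a z (\<lambda>x. f x z 0 - f_inf a x z) (\<lambda>x. g x z 0 - g_inf a x z))))"
proof -
  define M where "M = real_of_ereal (Linf_norm (deriv a))"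
  obtain D where D: "\<And>z. (a has_vector_derivative D z) (at z)" "continuous_on UNIV D"
    using assms(1) by (auto simp: C1_differentiable_on_def)
  then have da: "(a has_real_derivative D z) (at z)" for z
    by (simp add: has_real_derivative_iff_has_vector_derivative)
  then have "deriv a = D" by (intro ext DERIV_imp_deriv)
  with D(2) assms(5) have M: "\<bar>D z\<bar> \<le> M" for z
    using abs_le_Linf_norm[of "deriv a" z] by (simp add: M_def)
  have a0: "a0 \<le> a z" for z
    unfolding assms(3) by (intro cINF_lower assms(2)) simp
  have "decay_const a0 M > 0"
    using decay_const_bound(1)[OF assms(4) a0 M, of 0] by simp
  moreover have "(SUP z. pair_norm_sq a z (\<lambda>x. f x z t - f_inf a x z) (\<lambda>x. g x z t - g_inf a x z))
      \<le> ennreal (decay_const a0 M * (1 + t\<^sup>2) * exp (- 2 * a0 * t)) *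
        (SUP z. pair_norm_sq a z (\<lambda>x. f x z 0 - f_inf a x z) (\<lambda>x. g x z 0 - g_inf a x z))"
    if "solves_system a f g" "normalized a (\<lambda>x z. f x z 0) (\<lambda>x z. g x z 0)" "t \<ge> 0" for f g t
  proof (rule SUP_least)
    \<comment> \<open>The factor is the same for all z, so the pointwise estimate passes to suprema.
      In \<open>ennreal\<close> this includes the case of an infinite supremum at time 0.\<close>
    fix z
    show "pair_norm_sq a z (\<lambda>x. f x z t - f_inf a x z) (\<lambda>x. g x z t - g_inf a x z)
      \<le> ennreal (decay_const a0 M * (1 + t\<^sup>2) * exp (- 2 * a0 * t)) *
        (SUP z. pair_norm_sq a z (\<lambda>x. f x z 0 - f_inf a x z) (\<lambda>x. g x z 0 - g_inf a x z))"
      by (rule order_trans[OF solution_decay[OF assms(4) a0 da M that] mult_left_mono])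
        (auto intro: SUP_upper)
  qed
  ultimately show ?thesis
    unfolding M_def[symmetric] by blast
qed

end
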